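(* There exists $n_0\in\mathbb{N}$ such that for every even integer $n\geq n_0$, if $G$ is a strongly edge-colored graph on $n$ vertices with minimum degree $\delta(G)\geq\frac{n}{2}$, then $G$ contains a rainbow perfect matching.
   Context: All graphs are simple and finite. An edge-colored graph is a graph in which each edge is assigned a color. A color class is a maximal set of edges all having the same color. An edge-colored graph is strongly edge-colored if every color class is an induced matching (a matching $M$ such that no edge of the graph other than those of $M$ joins two vertices of $V(M)$). A subgraph is rainbow if its edges have pairwise distinct colors. *)

theory Defs
  imports Complex_Main
begin

(* Edges are two-element sets of vertices, so loops and parallel edges are excluded.
   An edge coloring is a function on vertex sets, of which only the values on edges
   ever matter; color classes in particular only contain edges. *)

definition simple_graph :: "'a set \<Rightarrow> 'a set set \<Rightarrow> bool" where
  "simple_graph V E \<longleftrightarrow> finite V \<and> (\<forall>e\<in>E. e \<subseteq> V \<and> card e = 2)"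

definition degree :: "'a set set \<Rightarrow> 'a \<Rightarrow> nat" where
  "degree E v = card {e \<in> E. v \<in> e}"

(* Unspecified on the empty graph. *)
definition min_degree :: "'a set \<Rightarrow> 'a set set \<Rightarrow> nat" where
  "min_degree V E = Min (degree E ` V)"

definition matching :: "'a set set \<Rightarrow> 'a set set \<Rightarrow> bool" where
  "matching E M \<longleftrightarrow> M \<subseteq> E \<and> pairwise disjnt M"

definition perfect_matching :: "'a set \<Rightarrow> 'a set set \<Rightarrow> 'a set set \<Rightarrow> bool" where
  "perfect_matching V E M \<longleftrightarrow> matching E M \<and> \<Union>M = V"

(* \<Union>M is the set V(M) of vertices covered by M. *)
definition induced_matching :: "'a set set \<Rightarrow> 'a set set \<Rightarrow> bool" where
  "induced_matching E M \<longleftrightarrow> matching E M \<and> (\<forall>e\<in>E. e \<subseteq> \<Union>M \<longrightarrow> e \<in> M)"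

definition monochromatic :: "('a set \<Rightarrow> 'c) \<Rightarrow> 'a set set \<Rightarrow> bool" where
  "monochromatic c S \<longleftrightarrow> (\<forall>e\<in>S. \<forall>f\<in>S. c e = c f)"

definition color_class :: "'a set set \<Rightarrow> ('a set \<Rightarrow> 'c) \<Rightarrow> 'a set set \<Rightarrow> bool" where
  "color_class E c S \<longleftrightarrow>
     S \<subseteq> E \<and> monochromatic c S \<and> (\<forall>T. S \<subseteq> T \<and> T \<subseteq> E \<and> monochromatic c T \<longrightarrow> T = S)"

definition strongly_edge_colored :: "'a set set \<Rightarrow> ('a set \<Rightarrow> 'c) \<Rightarrow> bool" where
  "strongly_edge_colored E c \<longleftrightarrow> (\<forall>S. color_class E c S \<longrightarrow> induced_matching E S)"

definition rainbow :: "('a set \<Rightarrow> 'c) \<Rightarrow> 'a set set \<Rightarrow> bool" where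
  "rainbow c S \<longleftrightarrow> inj_on c S"

end

theory Submission
  imports Defs
begin

text \<open>
  Take a rainbow matching \<open>M\<close> of maximum size and call a neighbor \<open>x\<close> of \<open>u\<close> good if the color of \<open>ux\<close>
  does not occur on \<open>M\<close>. If \<open>u\<close> and \<open>w\<close> are uncovered and \<open>xy \<in> M\<close>, the edges \<open>ux\<close> and \<open>wy\<close> are joined
  by \<open>xy\<close> and so have different colors; they cannot both be good, as \<open>xy\<close> could be exchanged for them.
  A Ruzsa--Szemeredi type energy increment shows that only \<open>o(n)\<close> color classes have linear size, so all
  but \<open>o(n)\<close> vertices have only \<open>o(n)\<close> bad neighbors, whatever \<open>M\<close> is. Rotating \<open>u\<close> and \<open>w\<close> to such
  typical vertices, let \<open>P\<close> and \<open>Q\<close> be the sets of \<open>M\<close>-partners of their good neighbors. Both have about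
  \<open>n/2\<close> elements, and a vertex of \<open>P\<close> has at most one good neighbor in \<open>Q\<close>. Hence either \<open>P \<approx> Q\<close> is
  nearly independent or \<open>P\<close> and \<open>Q\<close> are nearly disjoint cliques. In both extremal cases the exact degree
  condition repairs the imbalance or the parity of the two halves, the few atypical vertices are covered
  greedily, and the exchange argument finishes what is left.
\<close>

section \<open>Exchanges in rainbow matchings\<close>

text \<open>Minimum degree n/2 is exactly where the basic exchange stops giving a contradiction. For
  uncovered typical \<open>u\<close> and \<open>w\<close>, the partners of the good neighbors of
  \<open>u\<close> and the good neighbors of \<open>w\<close> are disjoint sets of about n/2
  vertices each, so they just fit into \<open>V\<close>. Only a second exchange, which first frees
  such a partner, reveals structure. In the extremal cases the basic exchange succeeds because it
  takes place inside one side of about n/2 vertices, where each of the two disjoint sets is larger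
  than half of that side.

  For an arbitrary uncovered vertex the number of bad neighbors is only bounded by n/4, hence the
  rotations. Typicality has to hold for all rainbow matchings at once, since rotations change
  \<open>M\<close> and residual graphs replace it. It does, because it is derived from the sizes of
  the color classes alone. The price is a starting value of tower type, although the stability
  argument itself only asks that the exceptional sets be a small constant fraction of n.\<close>

definition nbrs :: "'a set set \<Rightarrow> 'a \<Rightarrow> 'a set" where
  "nbrs E v = {x. {v, x} \<in> E}"

definition rainbow_matching :: "'a set set \<Rightarrow> ('a set \<Rightarrow> 'c) \<Rightarrow> 'a set set \<Rightarrow> bool" where
  "rainbow_matching E c M \<longleftrightarrow> matching E M \<and> rainbow c M"

definition max_rainbow_matching :: "'a set set \<Rightarrow> ('a set \<Rightarrow> 'c) \<Rightarrow> 'a set set \<Rightarrow> bool" where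
  "max_rainbow_matching E c M \<longleftrightarrow>
     rainbow_matching E c M \<and> (\<forall>M'. rainbow_matching E c M' \<longrightarrow> card M' \<le> card M)"

definition good :: "'a set set \<Rightarrow> ('a set \<Rightarrow> 'c) \<Rightarrow> 'a set set \<Rightarrow> 'a \<Rightarrow> 'a set" where
  "good E c M v = {x \<in> nbrs E v. c {v, x} \<notin> c ` M}"

definition bad :: "'a set set \<Rightarrow> ('a set \<Rightarrow> 'c) \<Rightarrow> 'a set set \<Rightarrow> 'a \<Rightarrow> 'a set" where
  "bad E c M v = {x \<in> nbrs E v. c {v, x} \<in> c ` M}"

definition partner :: "'a set set \<Rightarrow> 'a \<Rightarrow> 'a" where
  "partner M x = (THE y. {x, y} \<in> M)"

text \<open>The case \<open>x = y\<close> of \<open>strong\<close> says that the coloring is proper,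
  the other case that color classes are induced. In this pairwise form the property passes to
  subgraphs, to which the extremal cases apply the whole theory again.\<close>

locale strong_graph =
  fixes V :: "'a set" and E :: "'a set set" and c :: "'a set \<Rightarrow> 'c"
  assumes finite_V: "finite V"
    and edge_subset: "e \<in> E \<Longrightarrow> e \<subseteq> V"
    and edge_card: "e \<in> E \<Longrightarrow> card e = 2"
    and strong: "\<lbrakk>e \<in> E; f \<in> E; c e = c f; x \<in> e; y \<in> f; x = y \<or> {x, y} \<in> E\<rbrakk> \<Longrightarrow> e = f"
begin

section \<open>Basic facts on rainbow matchings and partners\<close>

lemma subgraph:
  assumes "E' \<subseteq> E" "V' \<subseteq> V" "\<And>e. e \<in> E' \<Longrightarrow> e \<subseteq> V'"
  shows "strong_graph V' E' c"
proof
  show "finite V'" using assms(2) finite_V finite_subset by blast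
  show "e \<subseteq> V'" if "e \<in> E'" for e using assms(3) that by simp
  show "card e = 2" if "e \<in> E'" for e using assms(1) edge_card that by blast
  show "e = f" if "e \<in> E'" "f \<in> E'" "c e = c f" "x \<in> e" "y \<in> f" "x = y \<or> {x, y} \<in> E'"
    for e f x y
    using strong[of e f x y] assms(1) that by blast
qed

lemma finite_E: "finite E"
  using finite_V edge_subset by (meson Pow_iff finite_Pow_iff finite_subset subsetI)

lemma edge_neq: "{x, y} \<in> E \<Longrightarrow> x \<noteq> y"
  using edge_card[of "{x, y}"] by auto

lemma edgeE:
  assumes "e \<in> E" obtains x y where "e = {x, y}" "x \<noteq> y" "x \<in> V" "y \<in> V"
  using edge_card[OF assms] edge_subset[OF assms] by (metis card_2_iff insert_subset)

lemma edge_in_V: "{x, y} \<in> E \<Longrightarrow> x \<in> V \<and> y \<in> V"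
  using edge_subset by blast

lemma nbrs_subset: "nbrs E v \<subseteq> V"
  using edge_in_V by (auto simp: nbrs_def)

lemma finite_nbrs: "finite (nbrs E v)"
  using nbrs_subset finite_V finite_subset by blast

lemma good_subset: "good E c M v \<subseteq> nbrs E v" and bad_subset: "bad E c M v \<subseteq> nbrs E v"
  by (auto simp: good_def bad_def)

lemma finite_good: "finite (good E c M v)" and finite_bad: "finite (bad E c M v)"
  using finite_nbrs good_subset bad_subset finite_subset by metis+

lemma card_good_bad: "card (nbrs E v) = card (good E c M v) + card (bad E c M v)"
proof -
  have "nbrs E v = good E c M v \<union> bad E c M v" "good E c M v \<inter> bad E c M v = {}"
    by (auto simp: good_def bad_def)
  then show ?thesis using finite_good finite_bad by (metis card_Un_disjoint)
qed

lemma rmD: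
  assumes "rainbow_matching E c M"
  shows "M \<subseteq> E" "\<And>e f x. \<lbrakk>e \<in> M; f \<in> M; x \<in> e; x \<in> f\<rbrakk> \<Longrightarrow> e = f" "inj_on c M" "finite M"
    "\<Union>M \<subseteq> V"
proof -
  show 1: "M \<subseteq> E" and "inj_on c M"
    using assms by (auto simp: rainbow_matching_def matching_def rainbow_def)
  show "\<And>e f x. \<lbrakk>e \<in> M; f \<in> M; x \<in> e; x \<in> f\<rbrakk> \<Longrightarrow> e = f"
    using assms by (auto simp: rainbow_matching_def matching_def pairwise_def disjnt_def)
  show "finite M" using 1 finite_E finite_subset by blast
  show "\<Union>M \<subseteq> V" using 1 edge_subset by blast
qed

lemma rmI:
  assumes "M \<subseteq> E" "\<And>e f x. \<lbrakk>e \<in> M; f \<in> M; x \<in> e; x \<in> f\<rbrakk> \<Longrightarrow> e = f" "inj_on c M"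
  shows "rainbow_matching E c M"
  using assms unfolding rainbow_matching_def matching_def rainbow_def pairwise_def disjnt_def
  by blast

lemma rm_empty: "rainbow_matching E c {}"
  by (auto intro!: rmI)

lemma rm_mono: "rainbow_matching E c M \<Longrightarrow> N \<subseteq> M \<Longrightarrow> rainbow_matching E c N"
  by (rule rmI) (auto dest: rmD intro: inj_on_subset)

lemma rm_insert:
  assumes "rainbow_matching E c M" "{a, b} \<in> E" "a \<notin> \<Union>M" "b \<notin> \<Union>M" "c {a, b} \<notin> c ` M"
  shows "rainbow_matching E c (insert {a, b} M)" "card (insert {a, b} M) = Suc (card M)"
proof -
  have n: "{a, b} \<notin> M" using assms by auto
  show "rainbow_matching E c (insert {a, b} M)"
    using assms n by (intro rmI) (auto dest: rmD)
  show "card (insert {a, b} M) = Suc (card M)" using n rmD(4)[OF assms(1)] by simp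
qed

lemma card_Union_matching:
  assumes "matching E M" shows "card (\<Union>M) = 2 * card M"
proof -
  have c2: "card e = 2" if "e \<in> M" for e using that assms edge_card by (auto simp: matching_def)
  have "card (\<Union>M) = sum card M"
  proof (rule card_Union_disjoint)
    show "pairwise disjnt M" using assms by (simp add: matching_def)
    show "finite e" if "e \<in> M" for e using c2[OF that] card_ge_0_finite by force
  qed
  also have "\<dots> = (\<Sum>e\<in>M. 2)" using c2 by (intro sum.cong) auto
  finally show ?thesis by simp
qed

lemma card_Union_rm: "rainbow_matching E c M \<Longrightarrow> card (\<Union>M) = 2 * card M"
  by (simp add: rainbow_matching_def card_Union_matching)

lemma max_rm_exists: obtains M where "max_rainbow_matching E c M"
proof -
  have "finite {M. rainbow_matching E c M}"
    using finite_E rmD(1) by (auto intro: finite_subset[of _ "Pow E"])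
  then have "finite (card ` {M. rainbow_matching E c M})" (is "finite ?C") by simp
  moreover have "?C \<noteq> {}" using rm_empty by blast
  ultimately have "Max ?C \<in> ?C" "\<forall>k\<in>?C. k \<le> Max ?C" by auto
  then obtain M where "rainbow_matching E c M" "\<forall>M'. rainbow_matching E c M' \<longrightarrow> card M' \<le> card M"
    by auto
  then show ?thesis using that by (auto simp: max_rainbow_matching_def)
qed

lemma partner_eq:
  assumes "rainbow_matching E c M" "{x, y} \<in> M" shows "partner M x = y"
  unfolding partner_def
proof (rule the_equality)
  fix z assume "{x, z} \<in> M"
  then show "z = y" using rmD(2)[OF assms(1,2), of "{x, z}" x] by (auto simp: doubleton_eq_iff)
qed fact

lemma partner:
  assumes "rainbow_matching E c M" "x \<in> \<Union>M"
  shows "{x, partner M x} \<in> M" "partner M (partner M x) = x" "partner M x \<noteq> x"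
    "partner M x \<in> \<Union>M"
proof -
  obtain e where e: "e \<in> M" "x \<in> e" using assms by auto
  obtain a b where ab: "e = {a, b}" "a \<noteq> b" using edgeE e rmD(1)[OF assms(1)] by (metis subsetD)
  then obtain y where y: "e = {x, y}" "x \<noteq> y" using e by auto
  have p: "partner M x = y" using partner_eq[OF assms(1)] y e by auto
  show "{x, partner M x} \<in> M" "partner M x \<noteq> x" "partner M x \<in> \<Union>M" using p y e by auto
  show "partner M (partner M x) = x"
    using partner_eq[OF assms(1), of y x] y e p by (simp add: insert_commute)
qed

lemma inj_on_partner: "rainbow_matching E c M \<Longrightarrow> inj_on (partner M) (\<Union>M)"
  by (metis inj_on_inverseI partner(2))

text \<open>A matching edge \<open>e\<close> with the color of \<open>ux\<close> cannot contain a
  neighbor of \<open>u\<close>: it would be joined to \<open>ux\<close>, so that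
  \<open>e = ux\<close>, although \<open>u\<close> is uncovered. Distinct bad neighbors yield
  distinct such edges, as the colors at \<open>u\<close> are distinct.\<close>

lemma bad_le:
  assumes M: "rainbow_matching E c M" and u: "u \<notin> \<Union>M"
  shows "card (bad E c M u) \<le> card {e \<in> M. e \<inter> nbrs E u = {}}"
proof -
  let ?f = "\<lambda>x. c {u, x}"
  have inj: "inj_on ?f (bad E c M u)"
  proof (rule inj_onI)
    fix x y assume "x \<in> bad E c M u" "y \<in> bad E c M u" "?f x = ?f y"
    then have "{u, x} = {u, y}" using strong[of "{u, x}" "{u, y}" u u] by (auto simp: bad_def nbrs_def)
    then show "x = y" by (auto simp: doubleton_eq_iff)
  qed
  have "?f ` bad E c M u \<subseteq> c ` {e \<in> M. e \<inter> nbrs E u = {}}"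
  proof
    fix k assume "k \<in> ?f ` bad E c M u"
    then obtain x e where x: "{u, x} \<in> E" "e \<in> M" "c {u, x} = c e" "k = c e"
      by (auto simp: bad_def nbrs_def)
    have "e \<inter> nbrs E u = {}"
    proof (rule ccontr)
      assume "e \<inter> nbrs E u \<noteq> {}"
      then obtain y where "y \<in> e" "{u, y} \<in> E" by (auto simp: nbrs_def)
      then have "{u, x} = e" using strong[of "{u, x}" e u y] x rmD(1)[OF M] by auto
      then show False using u x by auto
    qed
    then show "k \<in> c ` {e \<in> M. e \<inter> nbrs E u = {}}" using x by auto
  qed
  then have "card (?f ` bad E c M u) \<le> card (c ` {e \<in> M. e \<inter> nbrs E u = {}})"
    using rmD(4)[OF M] by (intro card_mono) auto
  also have "\<dots> \<le> card {e \<in> M. e \<inter> nbrs E u = {}}" using rmD(4)[OF M] by (intro card_image_le) auto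
  finally show ?thesis using card_image[OF inj] by simp
qed

text \<open>The matching edges that avoid all neighbors of \<open>u\<close> use up two non-neighbors
  each. With degree at least n/2 this leaves at least n/4 good neighbors at every uncovered vertex,
  typical or not.\<close>

lemma bad_le_degree:
  assumes M: "rainbow_matching E c M" and u: "u \<notin> \<Union>M"
  shows "2 * card (bad E c M u) + card (nbrs E u) \<le> card V"
proof -
  let ?P = "{e \<in> M. e \<inter> nbrs E u = {}}"
  have fin: "finite M" "finite (\<Union>M)" using rmD[OF M] finite_V finite_subset by auto
  have P: "card (\<Union>?P) = 2 * card ?P" by (rule card_Union_rm, rule rm_mono[OF M]) auto
  have "nbrs E u \<subseteq> V - \<Union>?P" using nbrs_subset by auto
  then have "card (nbrs E u) \<le> card (V - \<Union>?P)" using finite_V by (intro card_mono) auto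
  also have "\<dots> = card V - card (\<Union>?P)"
    using rmD(5)[OF M] finite_V by (intro card_Diff_subset) (auto intro: finite_subset)
  finally show ?thesis
    using P bad_le[OF M u] card_mono[OF finite_V, of "\<Union>?P"] rmD(5)[OF M] by force
qed

lemma rotate:
  assumes M: "rainbow_matching E c M" and xy: "{x, y} \<in> M" and u: "u \<notin> \<Union>M" and g: "x \<in> good E c M u"
  defines "M' \<equiv> insert {u, x} (M - {{x, y}})"
  shows "rainbow_matching E c M'" "card M' = card M" "\<Union>M' = insert u (\<Union>M - {y})"
    "c ` M' \<subseteq> insert (c {u, x}) (c ` M)"
proof -
  have ne: "x \<noteq> y" using xy rmD(1)[OF M] edge_neq by auto
  have D: "rainbow_matching E c (M - {{x, y}})" by (rule rm_mono[OF M]) auto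
  have U: "\<Union>(M - {{x, y}}) = \<Union>M - {x, y}" using rmD(2)[OF M _ xy] by blast
  have e: "{u, x} \<in> E" "c {u, x} \<notin> c ` M" using g by (auto simp: good_def nbrs_def)
  have "u \<notin> \<Union>(M - {{x, y}})" "x \<notin> \<Union>(M - {{x, y}})" "c {u, x} \<notin> c ` (M - {{x, y}})"
    using U u e(2) by auto
  note ins = rm_insert[OF D e(1) this]
  show "rainbow_matching E c M'" using ins(1) unfolding M'_def .
  show "card M' = card M" using ins(2) card.remove[OF rmD(4)[OF M] xy] unfolding M'_def by simp
  show "\<Union>M' = insert u (\<Union>M - {y})" using U xy ne u unfolding M'_def by auto
  show "c ` M' \<subseteq> insert (c {u, x}) (c ` M)" unfolding M'_def by auto
qed

lemma max_rotate:
  assumes "max_rainbow_matching E c M" "{x, y} \<in> M" "u \<notin> \<Union>M" "x \<in> good E c M u"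
  shows "max_rainbow_matching E c (insert {u, x} (M - {{x, y}}))"
  using rotate[of M x y u] assms by (auto simp: max_rainbow_matching_def)

lemma good_covered:
  assumes M: "max_rainbow_matching E c M" and u: "u \<notin> \<Union>M"
  shows "good E c M u \<subseteq> \<Union>M"
proof (rule subsetI, rule ccontr)
  fix x assume x: "x \<in> good E c M u" "x \<notin> \<Union>M"
  have "rainbow_matching E c M" using M by (simp add: max_rainbow_matching_def)
  from rm_insert[OF this, of u x] x u M show False
    by (auto simp: max_rainbow_matching_def good_def nbrs_def)
qed

lemma partner_good_disjoint:
  assumes M: "max_rainbow_matching E c M" and u: "u \<notin> \<Union>M" and w: "w \<notin> \<Union>M" "u \<noteq> w"
  shows "partner M ` good E c M u \<inter> good E c M w = {}"
proof (rule ccontr)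
  assume "partner M ` good E c M u \<inter> good E c M w \<noteq> {}"
  then obtain x where x: "x \<in> good E c M u" "partner M x \<in> good E c M w" by auto
  let ?y = "partner M x" and ?M' = "insert {u, x} (M - {{x, partner M x}})"
  have rm: "rainbow_matching E c M" using M by (simp add: max_rainbow_matching_def)
  have xM: "x \<in> \<Union>M" using good_covered[OF M u] x by auto
  note p = partner[OF rm xM]
  note r = rotate[OF rm p(1) u x(1)]
  have "c {w, ?y} \<noteq> c {u, x}"
  proof
    assume "c {w, ?y} = c {u, x}"
    then have "{w, ?y} = {u, x}"
      using strong[of "{w, ?y}" "{u, x}" ?y x] x p(1) rmD(1)[OF rm]
      by (auto simp: good_def nbrs_def insert_commute)
    then show False using w u xM by (auto simp: doubleton_eq_iff)
  qed
  moreover have "c {w, ?y} \<notin> c ` M" "{w, ?y} \<in> E" using x(2) by (auto simp: good_def nbrs_def)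
  moreover have "w \<notin> \<Union>?M'" "?y \<notin> \<Union>?M'" using r(3) w u p(4) by auto
  ultimately have "rainbow_matching E c (insert {w, ?y} ?M')" "card (insert {w, ?y} ?M') = Suc (card M)"
    using rm_insert[OF r(1), of w ?y] r(2,4) by auto
  then show False using M unfolding max_rainbow_matching_def by fastforce
qed

lemma card_partner_good:
  assumes M: "max_rainbow_matching E c M" and u: "u \<notin> \<Union>M"
  shows "card (partner M ` good E c M u) = card (good E c M u)"
proof -
  have "rainbow_matching E c M" using M by (simp add: max_rainbow_matching_def)
  then show ?thesis
    using good_covered[OF M u] by (intro card_image inj_on_subset[OF inj_on_partner])
qed

text \<open>Rotating \<open>u\<close> onto the partner of \<open>y\<close> frees \<open>y\<close>;
  rotating \<open>w\<close> onto the partner of some \<open>z\<close> in \<open>?Q\<close> frees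
  \<open>z\<close>. If \<open>yz\<close> were good, it could then be added, against maximality. The
  only obstruction is that the two rotation edges may have the same color. This color is determined
  by \<open>y\<close>, and at \<open>w\<close> it occurs only once, so at most one good
  \<open>z\<close> escapes.\<close>

lemma card_partner_good_nbrs:
  assumes M: "max_rainbow_matching E c M" and u: "u \<notin> \<Union>M" and w: "w \<notin> \<Union>M" "u \<noteq> w"
    and y: "y \<in> partner M ` good E c M u"
  shows "card (nbrs E y \<inter> partner M ` good E c M w) \<le> Suc (card (bad E c M y))"
proof -
  let ?Q = "partner M ` good E c M w" and ?x = "partner M y"
  have rm: "rainbow_matching E c M" using M by (simp add: max_rainbow_matching_def)
  obtain x' where x': "x' \<in> good E c M u" "y = partner M x'" using y by blast
  then have "x' \<in> \<Union>M" using good_covered[OF M u] by blast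
  then have x: "?x \<in> good E c M u" "y \<in> \<Union>M"
    using x' partner(2,4)[OF rm, of x'] by simp_all
  note px = partner[OF rm x(2)]
  note r = rotate[OF rm _ u x(1), of y, unfolded insert_commute[of ?x y], OF px(1)]
  let ?M1 = "insert {u, ?x} (M - {{y, ?x}})"
  have Q: "partner M z \<in> good E c M w \<and> z \<in> \<Union>M" if zQ: "z \<in> ?Q" for z
  proof -
    obtain z' where z': "z' \<in> good E c M w" "z = partner M z'" using zQ by blast
    then have "z' \<in> \<Union>M" using good_covered[OF M w(1)] by blast
    then show ?thesis using z' partner(2,4)[OF rm, of z'] by simp
  qed
  have col: "c {u, ?x} = c {w, partner M z}" if z: "z \<in> good E c M y \<inter> ?Q" for z
  proof (rule ccontr)
    assume ne: "c {u, ?x} \<noteq> c {w, partner M z}"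
    have z2: "partner M z \<in> good E c M w" "z \<in> \<Union>M" using Q[of z] z by auto
    note pz = partner[OF rm z2(2)]
    have zE: "{y, z} \<in> E" "c {y, z} \<notin> c ` M" using z by (auto simp: good_def nbrs_def)
    have zx: "z \<noteq> ?x"
      using partner_good_disjoint[OF M w(1) u] w x(1) z by auto
    have zy: "z \<noteq> y" using zE edge_neq by auto
    have e: "{partner M z, z} \<in> ?M1" using pz(1) zx zy by (auto simp: insert_commute doubleton_eq_iff)
    have wM1: "w \<notin> \<Union>?M1" using r(3) w by auto
    have gM1: "partner M z \<in> good E c ?M1 w"
      using z2(1) ne r(4) by (auto simp: good_def)
    note r2 = rotate[OF r(1) e wM1 gM1]
    let ?M2 = "insert {w, partner M z} (?M1 - {{partner M z, z}})"
    have "y \<noteq> u" "y \<noteq> w" "z \<noteq> w" using u w(1) x(2) z2(2) by blast+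
    then have no: "y \<notin> \<Union>?M2" "z \<notin> \<Union>?M2" unfolding r2(3) r(3) by blast+
    \<comment> \<open>The removed matching edges at \<open>y\<close> and at \<open>z\<close> join
      \<open>yz\<close> to the two new edges, so that equal colors are impossible.\<close>
    have "c {y, z} \<noteq> c {u, ?x}"
    proof
      assume "c {y, z} = c {u, ?x}"
      then have "{y, z} = {u, ?x}"
        using strong[of "{y, z}" "{u, ?x}" y ?x] zE px(1) rmD(1)[OF rm] x(1)
        by (auto simp: good_def nbrs_def)
      then show False using u x z2 by (auto simp: doubleton_eq_iff)
    qed
    moreover have "c {y, z} \<noteq> c {w, partner M z}"
    proof
      assume "c {y, z} = c {w, partner M z}"
      then have "{y, z} = {w, partner M z}"
        using strong[of "{y, z}" "{w, partner M z}" z "partner M z"] zE pz(1) rmD(1)[OF rm] z2(1)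
        by (auto simp: good_def nbrs_def)
      then show False using w x z2 by (auto simp: doubleton_eq_iff)
    qed
    ultimately have "c {y, z} \<notin> c ` ?M2" using zE r(4) by auto
    from rm_insert[OF r2(1) zE(1) no this] r(2) r2(2) show False
      using M by (auto simp: max_rainbow_matching_def)
  qed
  have "card (good E c M y \<inter> ?Q) \<le> Suc 0"
  proof (subst card_le_Suc0_iff_eq)
    show "finite (good E c M y \<inter> ?Q)" using finite_good by auto
    show "\<forall>z\<in>good E c M y \<inter> ?Q. \<forall>z'\<in>good E c M y \<inter> ?Q. z = z'"
    proof (intro ballI)
      fix z z' assume z: "z \<in> good E c M y \<inter> ?Q" "z' \<in> good E c M y \<inter> ?Q"
      have q: "partner M z \<in> good E c M w" "z \<in> \<Union>M" "partner M z' \<in> good E c M w" "z' \<in> \<Union>M"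
        using z Q by auto
      have "c {w, partner M z} = c {w, partner M z'}" using col[OF z(1)] col[OF z(2)] by simp
      then have "{w, partner M z} = {w, partner M z'}"
        using strong[of "{w, partner M z}" "{w, partner M z'}" w w] q
        by (auto simp: good_def nbrs_def)
      then have "partner M z = partner M z'" by (auto simp: doubleton_eq_iff)
      then show "z = z'" using partner(2)[OF rm] q by metis
    qed
  qed
  moreover have "nbrs E y \<inter> ?Q \<subseteq> (good E c M y \<inter> ?Q) \<union> bad E c M y"
    by (auto simp: good_def bad_def)
  then have "card (nbrs E y \<inter> ?Q) \<le> card (good E c M y \<inter> ?Q) + card (bad E c M y)"
    using finite_good finite_bad by (meson card_Un_le card_mono finite_Int finite_Un order_trans)
  ultimately show ?thesis by simp
qed

end

section \<open>Stability and near-complete graphs\<close>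

context strong_graph
begin

section \<open>Rotating to typical vertices\<close>

lemma inj_on_color_nbrs: "inj_on (\<lambda>x. c {v, x}) (nbrs E v)"
proof (rule inj_onI)
  fix x y assume "x \<in> nbrs E v" "y \<in> nbrs E v" "c {v, x} = c {v, y}"
  then have "{v, x} = {v, y}" using strong[of "{v, x}" "{v, y}" v v] by (auto simp: nbrs_def)
  then show "x = y" by (auto simp: doubleton_eq_iff)
qed

lemma card_bad_le:
  assumes M: "rainbow_matching E c M" shows "card (bad E c M v) \<le> card M"
proof -
  have "card (bad E c M v) = card ((\<lambda>x. c {v, x}) ` bad E c M v)"
    using inj_on_subset[OF inj_on_color_nbrs bad_subset] by (simp add: card_image)
  also have "\<dots> \<le> card (c ` M)"
    using rmD(4)[OF M] by (intro card_mono) (auto simp: bad_def)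
  also have "\<dots> \<le> card M" using rmD(4)[OF M] card_image_le by blast
  finally show ?thesis .
qed

lemma card_bad_insert_color:
  assumes "c ` M' \<subseteq> insert k (c ` M)"
  shows "card (bad E c M' v) \<le> Suc (card (bad E c M v))"
proof -
  let ?K = "{x \<in> nbrs E v. c {v, x} = k}"
  have "card ?K \<le> Suc 0"
  proof (subst card_le_Suc0_iff_eq)
    show "finite ?K" using finite_nbrs by simp
    show "\<forall>x\<in>?K. \<forall>y\<in>?K. x = y" using inj_onD[OF inj_on_color_nbrs] by blast
  qed
  moreover have "bad E c M' v \<subseteq> ?K \<union> bad E c M v" using assms by (auto simp: bad_def)
  then have "card (bad E c M' v) \<le> card (?K \<union> bad E c M v)"
    using finite_nbrs finite_bad by (intro card_mono) auto
  then have "card (bad E c M' v) \<le> card ?K + card (bad E c M v)"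
    using card_Un_le[of ?K "bad E c M v"] by linarith
  ultimately show ?thesis by linarith
qed

text \<open>By \<open>bad_le_degree\<close>, \<open>deg\<close> gives \<open>u\<close> more than
  \<open>b\<close> good neighbors. Their partners cannot all be atypical, and rotating frees a
  typical one. The rotation adds one color, which costs one more bad neighbor at most. The set
  \<open>W\<close>, closed under adjacency, keeps the freed vertex on the side of
  \<open>u\<close>.\<close>

lemma rotate_to_typical:
  assumes typical: "\<And>M. rainbow_matching E c M \<Longrightarrow> card {v \<in> V. b < card (bad E c M v)} \<le> b"
    and M: "max_rainbow_matching E c M" and u: "u \<notin> \<Union>M" "u \<in> W"
    and closed: "\<And>e. e \<in> E \<Longrightarrow> e \<inter> W \<noteq> {} \<Longrightarrow> e \<subseteq> W"
    and deg: "card V + 2 * b < 3 * card (nbrs E u)"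
  obtains M' y where "max_rainbow_matching E c M'" "y \<in> W" "y \<in> \<Union>M" "\<Union>M' = insert u (\<Union>M - {y})"
    "card (bad E c M' y) \<le> Suc b" "\<forall>v. card (bad E c M' v) \<le> Suc (card (bad E c M v))"
proof -
  have rm: "rainbow_matching E c M" using M by (simp add: max_rainbow_matching_def)
  have "b < card (good E c M u)"
    using bad_le_degree[OF rm u(1)] card_good_bad[of u M] deg by linarith
  then have "\<not> partner M ` good E c M u \<subseteq> {v \<in> V. b < card (bad E c M v)}"
    using typical[OF rm] card_partner_good[OF M u(1)] finite_V
      card_mono[of "{v \<in> V. b < card (bad E c M v)}" "partner M ` good E c M u"] by auto
  then obtain x where x: "x \<in> good E c M u" "\<not> (partner M x \<in> V \<and> b < card (bad E c M (partner M x)))"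
    by auto
  have xM: "x \<in> \<Union>M" using good_covered[OF M u(1)] x by auto
  note p = partner[OF rm xM]
  let ?y = "partner M x"
  have y: "card (bad E c M ?y) \<le> b" using x p(4) rmD(5)[OF rm] by auto
  let ?M' = "insert {u, x} (M - {{x, ?y}})"
  note r = rotate[OF rm p(1) u(1) x(1)]
  have "{u, x} \<subseteq> W" using closed[of "{u, x}"] x u(2) by (auto simp: good_def nbrs_def)
  then have "?y \<in> W" using closed[of "{x, ?y}"] p(1) rmD(1)[OF rm] by auto
  moreover have "card (bad E c ?M' v) \<le> Suc (card (bad E c M v))" for v
    by (rule card_bad_insert_color[OF r(4)])
  moreover from this[of ?y] y have "card (bad E c ?M' ?y) \<le> Suc b" by linarith
  ultimately show ?thesis
    using that[of ?M' ?y] max_rotate[OF M p(1) u(1) x(1)] r(3) p(4) by blast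
qed

text \<open>Two successive rotations. The vertex freed first suffers from two new colors, whence
  \<open>b + 2\<close>; it stays uncovered, and differs from the second one because that one is
  still covered after the first rotation.\<close>

lemma two_typical_uncovered:
  assumes typical: "\<And>M. rainbow_matching E c M \<Longrightarrow> card {v \<in> V. b < card (bad E c M v)} \<le> b"
    and M: "max_rainbow_matching E c M"
    and u: "u \<notin> \<Union>M" "u \<in> W" and w: "w \<notin> \<Union>M" "w \<in> W" "u \<noteq> w"
    and closed: "\<And>e. e \<in> E \<Longrightarrow> e \<inter> W \<noteq> {} \<Longrightarrow> e \<subseteq> W"
    and deg: "\<And>v. v \<in> W \<Longrightarrow> card V + 2 * b < 3 * card (nbrs E v)"
  obtains M' u' w' where "max_rainbow_matching E c M'" "u' \<notin> \<Union>M'" "w' \<notin> \<Union>M'" "u' \<noteq> w'"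
    "u' \<in> W" "w' \<in> W" "card (bad E c M' u') \<le> b + 2" "card (bad E c M' w') \<le> b + 2"
proof -
  obtain M1 y where 1: "max_rainbow_matching E c M1" "y \<in> W" "y \<in> \<Union>M" "\<Union>M1 = insert u (\<Union>M - {y})"
    "card (bad E c M1 y) \<le> Suc b" "\<forall>v. card (bad E c M1 v) \<le> Suc (card (bad E c M v))"
    by (rule rotate_to_typical[OF typical M u closed deg[OF u(2)]])
  have w1: "w \<notin> \<Union>M1" using 1(4) w by auto
  obtain M2 z where 2: "max_rainbow_matching E c M2" "z \<in> W" "z \<in> \<Union>M1" "\<Union>M2 = insert w (\<Union>M1 - {z})"
    "card (bad E c M2 z) \<le> Suc b" "\<forall>v. card (bad E c M2 v) \<le> Suc (card (bad E c M1 v))"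
    by (rule rotate_to_typical[OF typical 1(1) w1 w(2) closed deg[OF w(2)]])
  have "y \<notin> \<Union>M1" using 1 u by auto
  then have "y \<notin> \<Union>M2" "z \<notin> \<Union>M2" "y \<noteq> z" unfolding 2(4) using 2(3) 1(3) w(1) w1 by blast+
  moreover have "card (bad E c M2 y) \<le> b + 2" using spec[OF 2(6), of y] 1(5) by linarith
  ultimately show ?thesis using that[of M2 y z] 2 1 by simp
qed

lemma even_card_covered:
  assumes M: "rainbow_matching E c M" and closed: "\<And>e. e \<in> M \<Longrightarrow> e \<inter> W \<noteq> {} \<Longrightarrow> e \<subseteq> W"
  shows "even (card (\<Union>M \<inter> W))"
proof -
  have "\<Union>M \<inter> W = \<Union>{e \<in> M. e \<subseteq> W}" using closed by blast
  then show ?thesis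
    using card_Union_rm[OF rm_mono[OF M, of "{e \<in> M. e \<subseteq> W}"]] by auto
qed

text \<open>Each part is even and no edge leaves it, so an uncovered vertex comes with a second one
  in the same part \<open>W\<close>. After moving both to typical vertices of \<open>W\<close>, the
  two disjoint sets of \<open>partner_good_disjoint\<close> lie in \<open>W\<close>, and each has
  more than half of its elements.\<close>

lemma perfect_near_cliques:
  assumes V: "V = W1 \<union> W2" "W1 \<inter> W2 = {}" and even: "even (card W1)" "even (card W2)"
    and E: "\<And>e. e \<in> E \<Longrightarrow> e \<subseteq> W1 \<or> e \<subseteq> W2"
    and typical: "\<And>M. rainbow_matching E c M \<Longrightarrow> card {v \<in> V. b < card (bad E c M v)} \<le> b"
    and deg: "\<And>v. v \<in> V \<Longrightarrow> card V + 2 * b < 3 * card (nbrs E v)"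
    and deg1: "\<And>v. v \<in> W1 \<Longrightarrow> card W1 + 2 * b + 4 < 2 * card (nbrs E v)"
    and deg2: "\<And>v. v \<in> W2 \<Longrightarrow> card W2 + 2 * b + 4 < 2 * card (nbrs E v)"
  obtains M where "rainbow_matching E c M" "\<Union>M = V"
proof -
  obtain M where M: "max_rainbow_matching E c M" using max_rm_exists .
  then have rm: "rainbow_matching E c M" by (simp add: max_rainbow_matching_def)
  have part: False if W: "W \<subseteq> V" "even (card W)" "\<And>e. e \<in> E \<Longrightarrow> e \<inter> W \<noteq> {} \<Longrightarrow> e \<subseteq> W"
    "\<And>v. v \<in> W \<Longrightarrow> card W + 2 * b + 4 < 2 * card (nbrs E v)" "u \<in> W" "u \<notin> \<Union>M" for W u
  proof -
    have fW: "finite W" using W(1) finite_V finite_subset by blast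
    have ev: "even (card (\<Union>M \<inter> W))" using even_card_covered[OF rm, of W] W(3) rmD(1)[OF rm] by blast
    have "card (W - \<Union>M) + card (\<Union>M \<inter> W) = card W"
      using card_Int_Diff[OF fW, of "\<Union>M"] by (simp add: Int_commute)
    then have "even (card (W - \<Union>M))" using ev W(2) by presburger
    moreover have "card (W - \<Union>M) \<noteq> 0" using W(5,6) fW by auto
    ultimately have "\<not> card (W - \<Union>M) \<le> Suc 0" by presburger
    then obtain w where w: "w \<in> W" "w \<notin> \<Union>M" "u \<noteq> w"
      using fW by (subst (asm) card_le_Suc0_iff_eq) (use W(5,6) in blast)+
    obtain M' u' w' where M': "max_rainbow_matching E c M'" "u' \<notin> \<Union>M'" "w' \<notin> \<Union>M'" "u' \<noteq> w'"
      "u' \<in> W" "w' \<in> W" "card (bad E c M' u') \<le> b + 2" "card (bad E c M' w') \<le> b + 2"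
      by (rule two_typical_uncovered[OF typical M W(6,5) w(2,1,3) W(3)]) (use deg W(1) in auto)
    have rm': "rainbow_matching E c M'" using M'(1) by (simp add: max_rainbow_matching_def)
    have inW: "good E c M' v \<subseteq> W" if "v \<in> W" for v
      using W(3) that by (fastforce simp: good_def nbrs_def)
    let ?P = "partner M' ` good E c M' u'" and ?B = "good E c M' w'"
    have "?P \<subseteq> W"
    proof
      fix y assume "y \<in> ?P"
      then obtain x where x: "x \<in> good E c M' u'" "y = partner M' x" by blast
      then have "{x, y} \<in> M'" using partner(1)[OF rm', of x] good_covered[OF M'(1,2)] by blast
      then show "y \<in> W" using W(3)[of "{x, y}"] rmD(1)[OF rm'] inW[OF M'(5)] x by auto
    qed
    moreover have "?P \<inter> ?B = {}" by (rule partner_good_disjoint[OF M'(1-4)])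
    moreover have "finite ?P" using finite_good by simp
    ultimately have "card ?P + card ?B \<le> card W"
      using inW[OF M'(6)] fW finite_good[of M' w'] card_mono[OF fW, of "?P \<union> ?B"]
        card_Un_disjoint[of ?P ?B] by simp
    moreover have "card W < 2 * card ?P"
      using card_partner_good[OF M'(1,2)] W(4)[OF M'(5)] M'(7) card_good_bad[of u' M'] by linarith
    moreover have "card W < 2 * card ?B"
      using W(4)[OF M'(6)] M'(8) card_good_bad[of w' M'] by linarith
    ultimately show False by linarith
  qed
  have cl: "e \<subseteq> W1" if "e \<in> E" "e \<inter> W1 \<noteq> {}" for e using E[OF that(1)] that V by blast
  have cl2: "e \<subseteq> W2" if "e \<in> E" "e \<inter> W2 \<noteq> {}" for e using E[OF that(1)] that V by blast
  have "V \<subseteq> \<Union>M"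
  proof
    fix v assume "v \<in> V"
    then show "v \<in> \<Union>M"
      using part[of W1 v, OF _ even(1) cl deg1] part[of W2 v, OF _ even(2) cl2 deg2] V(1) by blast
  qed
  then show ?thesis using that rm rmD(5)[OF rm] by blast
qed

section \<open>Near-complete bipartite graphs and auxiliary matchings\<close>

lemma card_covered_sides:
  assumes P: "rainbow_matching E c P" and XY: "X \<inter> Y = {}" and sides: "\<And>e. e \<in> P \<Longrightarrow> \<exists>x\<in>X. \<exists>y\<in>Y. e = {x, y}"
  shows "card (\<Union>P \<inter> X) = card P \<and> card (\<Union>P \<inter> Y) = card P"
proof -
  have *: "card (e \<inter> X) = 1 \<and> card (e \<inter> Y) = 1" if "e \<in> P" for e
  proof -
    obtain x y where "x \<in> X" "y \<in> Y" "e = {x, y}" using sides \<open>e \<in> P\<close> by blast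
    then have "e \<inter> X = {x}" "e \<inter> Y = {y}" using XY by auto
    then show ?thesis by simp
  qed
  have "card (\<Union>e\<in>P. e \<inter> X) \<le> (\<Sum>e\<in>P. card (e \<inter> X))" "card (\<Union>e\<in>P. e \<inter> Y) \<le> (\<Sum>e\<in>P. card (e \<inter> Y))"
    using rmD(4)[OF P] by (intro card_UN_le; simp)+
  moreover have "(\<Union>e\<in>P. e \<inter> X) = \<Union>P \<inter> X" "(\<Union>e\<in>P. e \<inter> Y) = \<Union>P \<inter> Y" by auto
  ultimately have le: "card (\<Union>P \<inter> X) \<le> card P" "card (\<Union>P \<inter> Y) \<le> card P" using * by simp_all
  have "\<Union>P \<subseteq> (\<Union>P \<inter> X) \<union> (\<Union>P \<inter> Y)" using sides by blast
  moreover have "finite (\<Union>P)" using rmD(5)[OF P] finite_V finite_subset by blast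
  ultimately have "card (\<Union>P) \<le> card ((\<Union>P \<inter> X) \<union> (\<Union>P \<inter> Y))" by (intro card_mono) auto
  then have "card (\<Union>P) \<le> card (\<Union>P \<inter> X) + card (\<Union>P \<inter> Y)"
    using card_Un_le[of "\<Union>P \<inter> X" "\<Union>P \<inter> Y"] by linarith
  then show ?thesis using le card_Union_rm[OF P] by linarith
qed

text \<open>Matching edges that avoid the neighbors of \<open>u\<close> use distinct non-neighbors
  on the opposite side, so there are at most \<open>k - card (nbrs E u)\<close> bad neighbors. With
  degree above 3k/4 more than k/2 neighbors are good, at \<open>u\<close> and likewise at
  \<open>w\<close>. Partners of the former and the latter are disjoint subsets of \<open>X\<close>,
  which has only \<open>k\<close> elements.\<close>

lemma perfect_near_complete_bipartite:
  assumes V: "V = X \<union> Y" "X \<inter> Y = {}" and card: "card X = k" "card Y = k"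
    and E: "\<And>e. e \<in> E \<Longrightarrow> \<exists>x\<in>X. \<exists>y\<in>Y. e = {x, y}"
    and deg: "\<And>v. v \<in> V \<Longrightarrow> 3 * k < 4 * card (nbrs E v)"
  obtains M where "rainbow_matching E c M" "\<Union>M = V"
proof -
  obtain M where M: "max_rainbow_matching E c M" using max_rm_exists .
  then have rm: "rainbow_matching E c M" by (simp add: max_rainbow_matching_def)
  have fin: "finite X" "finite Y" using V finite_V by auto
  have eq: "card (\<Union>P \<inter> X) = card P \<and> card (\<Union>P \<inter> Y) = card P" if "rainbow_matching E c P" for P
    using card_covered_sides[OF that V(2)] E rmD(1)[OF that] by blast
  have "\<Union>M = V"
  proof (rule ccontr)
    assume "\<Union>M \<noteq> V"
    moreover have "\<Union>M = (\<Union>M \<inter> X) \<union> (\<Union>M \<inter> Y)" using rmD(5)[OF rm] V by blast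
    ultimately have "card M < k"
      using eq[OF rm] card fin V psubset_card_mono[of X "\<Union>M \<inter> X"] psubset_card_mono[of Y "\<Union>M \<inter> Y"]
      by (metis Int_lower2 psubsetI)
    then obtain u w where u: "u \<in> X" "u \<notin> \<Union>M" and w: "w \<in> Y" "w \<notin> \<Union>M"
      using eq[OF rm] card by (metis Int_absorb1 less_irrefl subsetI)
    have nX: "nbrs E v \<subseteq> Y" if "v \<in> X" for v
      using E that V by (fastforce simp: nbrs_def doubleton_eq_iff)
    have nY: "nbrs E v \<subseteq> X" if "v \<in> Y" for v
      using E that V by (fastforce simp: nbrs_def doubleton_eq_iff)
    have badX: "card (bad E c M u) + card (nbrs E u) \<le> k"
    proof -
      let ?P = "{e \<in> M. e \<inter> nbrs E u = {}}"
      have "card ?P = card (\<Union>?P \<inter> Y)" using eq[OF rm_mono[OF rm], of ?P] by auto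
      also have "\<dots> \<le> card (Y - nbrs E u)" using fin by (intro card_mono) auto
      also have "\<dots> = k - card (nbrs E u)" using nX[OF u(1)] card finite_nbrs by (simp add: card_Diff_subset)
      finally show ?thesis using bad_le[OF rm u(2)] card_mono[OF fin(2) nX[OF u(1)]] card by linarith
    qed
    have badY: "card (bad E c M w) + card (nbrs E w) \<le> k"
    proof -
      let ?P = "{e \<in> M. e \<inter> nbrs E w = {}}"
      have "card ?P = card (\<Union>?P \<inter> X)" using eq[OF rm_mono[OF rm], of ?P] by auto
      also have "\<dots> \<le> card (X - nbrs E w)" using fin by (intro card_mono) auto
      also have "\<dots> = k - card (nbrs E w)" using nY[OF w(1)] card finite_nbrs by (simp add: card_Diff_subset)
      finally show ?thesis using bad_le[OF rm w(2)] card_mono[OF fin(1) nY[OF w(1)]] card by linarith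
    qed
    let ?P = "partner M ` good E c M u" and ?B = "good E c M w"
    have "?P \<subseteq> X"
    proof
      fix y assume "y \<in> ?P"
      then obtain x where x: "x \<in> good E c M u" "y = partner M x" by blast
      then have "{x, y} \<in> M" using partner(1)[OF rm, of x] good_covered[OF M u(2)] by blast
      then show "y \<in> X" using nY[of x] x nX[OF u(1)] rmD(1)[OF rm] by (auto simp: good_def nbrs_def)
    qed
    moreover have "?B \<subseteq> X" using nY[OF w(1)] good_subset by blast
    moreover have "?P \<inter> ?B = {}" using partner_good_disjoint[OF M u(2) w(2)] u w V by blast
    moreover have "finite ?P" using finite_good by simp
    ultimately have "card ?P + card ?B \<le> k"
      using fin finite_good[of M w] card_mono[OF fin(1), of "?P \<union> ?B"]
        card_Un_disjoint[of ?P ?B] card(1) by simp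
    moreover have "u \<in> V" "w \<in> V" using u w V by auto
    ultimately show False
      using card_partner_good[OF M u(2)] badX badY deg[of u] deg[of w]
        card_good_bad[of u M] card_good_bad[of w M] by linarith
  qed
  then show ?thesis using that rm by blast
qed

text \<open>If \<open>card M < d\<close>, then an uncovered vertex has more good neighbors than
  there are matching edges meeting its neighborhood, so both ends of some matching edge are good for
  it. As \<open>3 * d \<le> card V\<close>, there are more uncovered vertices than matching edges,
  and two of them share such an edge, which allows an exchange. This matching later corrects the
  imbalance of a near-bipartite graph.\<close>

lemma rainbow_matching_of_size_min_degree:
  assumes deg: "\<And>v. v \<in> V \<Longrightarrow> d \<le> card (nbrs E v)" and V: "3 * d \<le> card V"
  obtains M where "rainbow_matching E c M" "card M = d"
proof -
  obtain M where M: "max_rainbow_matching E c M" using max_rm_exists .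
  then have rm: "rainbow_matching E c M" by (simp add: max_rainbow_matching_def)
  have "d \<le> card M"
  proof (rule ccontr)
    assume less: "\<not> d \<le> card M"
    have two: "\<exists>e. e \<in> M \<and> e \<subseteq> good E c M u" if u: "u \<in> V - \<Union>M" for u
    proof (rule ccontr)
      assume no: "\<nexists>e. e \<in> M \<and> e \<subseteq> good E c M u"
      let ?P = "{e \<in> M. e \<inter> nbrs E u = {}}"
      have one: "card (e \<inter> good E c M u) \<le> 1" if "e \<in> M" for e
      proof -
        have e: "card e = 2" "finite e" using that rmD(1)[OF rm] edge_card card_ge_0_finite by force+
        have "e \<inter> good E c M u \<subset> e" using no that by blast
        then have "card (e \<inter> good E c M u) < card e" using e by (intro psubset_card_mono)
        then show ?thesis using e by simp
      qed
      have "good E c M u \<subseteq> (\<Union>e\<in>M - ?P. e \<inter> good E c M u)"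
        using good_covered[OF M, of u] good_subset[of M u] u by blast
      then have "card (good E c M u) \<le> card (\<Union>e\<in>M - ?P. e \<inter> good E c M u)"
        using rmD(4)[OF rm] finite_good by (intro card_mono) auto
      also have "\<dots> \<le> (\<Sum>e\<in>M - ?P. card (e \<inter> good E c M u))" using rmD(4)[OF rm] by (intro card_UN_le) auto
      also have "\<dots> \<le> (\<Sum>e\<in>M - ?P. 1)" using one by (intro sum_mono) auto
      also have "\<dots> = card M - card ?P" using rmD(4)[OF rm] by (simp add: card_Diff_subset)
      finally show False
        using bad_le[OF rm, of u] u deg[of u] card_good_bad[of u M] less card_mono[OF rmD(4)[OF rm], of ?P]
        by force
    qed
    define f where "f u = (SOME e. e \<in> M \<and> e \<subseteq> good E c M u)" for u
    have f: "f u \<in> M \<and> f u \<subseteq> good E c M u" if "u \<in> V - \<Union>M" for u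
      using someI_ex[OF two[OF that]] unfolding f_def .
    have "card (V - \<Union>M) = card V - 2 * card M"
      using card_Union_rm[OF rm] rmD(5)[OF rm] finite_V by (metis card_Diff_subset finite_subset)
    then have "card M < card (V - \<Union>M)" using less V by linarith
    then have "\<not> inj_on f (V - \<Union>M)"
      using f rmD(4)[OF rm] card_inj_on_le[of f "V - \<Union>M" M] by (metis image_subsetI not_le)
    then obtain u w where uw: "u \<in> V - \<Union>M" "w \<in> V - \<Union>M" "u \<noteq> w" "f u = f w" by (auto simp: inj_on_def)
    obtain x y where xy: "f u = {x, y}" using edgeE f[OF uw(1)] rmD(1)[OF rm] by (metis subsetD)
    have "partner M x = y" using partner_eq[OF rm] f[OF uw(1)] xy by simp
    then have "y \<in> partner M ` good E c M u \<inter> good E c M w"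
      using f[OF uw(1)] f[OF uw(2)] uw(4) xy by auto
    then show False using partner_good_disjoint[OF M, of u w] uw by blast
  qed
  then obtain N where "N \<subseteq> M" "card N = d" using obtain_subset_with_card_n by metis
  then show ?thesis using that rm_mono[OF rm] by blast
qed

text \<open>A matching with \<open>m\<close> edges blocks \<open>2 * m\<close> vertices and, by its
  colors, at most \<open>m\<close> further neighbors of \<open>z\<close>; this explains the factor
  3. Keeping \<open>R z\<close> disjoint from \<open>Z\<close> prevents one vertex of
  \<open>Z\<close> from being used up on behalf of another.\<close>

lemma greedy_extend:
  assumes "finite Z" "rainbow_matching E c N" "Z \<inter> \<Union>N = {}"
    and "\<And>z. z \<in> Z \<Longrightarrow> R z \<subseteq> nbrs E z \<and> R z \<inter> Z = {} \<and> 3 * (card N + card Z) \<le> card (R z)"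
  shows "\<exists>N'. rainbow_matching E c N' \<and> N \<subseteq> N' \<and> Z \<subseteq> \<Union>N' \<and> card N' = card N + card Z \<and>
    (\<forall>e\<in>N' - N. \<exists>z\<in>Z. \<exists>x\<in>R z. e = {z, x})"
  using assms
proof (induction Z rule: finite_induct)
  case empty
  then show ?case by (intro exI[of _ N]) auto
next
  case (insert z Z)
  have "\<exists>N'. rainbow_matching E c N' \<and> N \<subseteq> N' \<and> Z \<subseteq> \<Union>N' \<and> card N' = card N + card Z \<and>
    (\<forall>e\<in>N' - N. \<exists>z\<in>Z. \<exists>x\<in>R z. e = {z, x})"
  proof (rule insert.IH)
    show "Z \<inter> \<Union>N = {}" using insert.prems by auto
    show "R y \<subseteq> nbrs E y \<and> R y \<inter> Z = {} \<and> 3 * (card N + card Z) \<le> card (R y)" if "y \<in> Z" for y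
      using insert.prems(3)[of y] that insert.hyps by auto
  qed (use insert.prems in simp)
  then obtain N' where N': "rainbow_matching E c N'" "N \<subseteq> N'" "Z \<subseteq> \<Union>N'" "card N' = card N + card Z"
    "\<forall>e\<in>N' - N. \<exists>z\<in>Z. \<exists>x\<in>R z. e = {z, x}" by blast
  have Rz: "R z \<subseteq> nbrs E z" "R z \<inter> insert z Z = {}" "3 * (card N + Suc (card Z)) \<le> card (R z)"
    using insert.prems(3)[of z] insert.hyps by auto
  have "\<not> R z \<subseteq> \<Union>N' \<union> bad E c N' z"
  proof
    assume "R z \<subseteq> \<Union>N' \<union> bad E c N' z"
    then have "card (R z) \<le> card (\<Union>N' \<union> bad E c N' z)"
      using rmD(5)[OF N'(1)] finite_V finite_bad by (intro card_mono) (auto intro: finite_subset)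
    also have "\<dots> \<le> card (\<Union>N') + card (bad E c N' z)" by (rule card_Un_le)
    also have "\<dots> \<le> 3 * card N'" using card_Union_rm[OF N'(1)] card_bad_le[OF N'(1), of z] by linarith
    finally show False using Rz(3) N'(4) by simp
  qed
  then obtain x where x: "x \<in> R z" "x \<notin> \<Union>N'" "x \<notin> bad E c N' z" by blast
  have e: "{z, x} \<in> E" "c {z, x} \<notin> c ` N'" using x Rz(1) by (auto simp: bad_def nbrs_def)
  have z: "z \<notin> \<Union>N'"
  proof
    assume "z \<in> \<Union>N'"
    then obtain e where e: "e \<in> N'" "z \<in> e" by blast
    have "e \<notin> N" using e insert.prems(2) by blast
    then obtain y x' where "y \<in> Z" "x' \<in> R y" "e = {y, x'}" using N'(5) e by blast
    then show False using e insert.prems(3)[of y] insert.hyps by auto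
  qed
  have "rainbow_matching E c (insert {z, x} N')" "card (insert {z, x} N') = Suc (card N')"
    using rm_insert[OF N'(1) e(1) z x(2) e(2)] by auto
  moreover have "insert z Z \<subseteq> \<Union>(insert {z, x} N')" using N'(3) by auto
  moreover have "\<forall>e\<in>insert {z, x} N' - N. \<exists>z\<in>insert z Z. \<exists>x\<in>R z. e = {z, x}" using N'(5) x(1) by blast
  ultimately show ?case using N'(2,4) insert.hyps by (intro exI[of _ "insert {z, x} N'"]) auto
qed

text \<open>For typical uncovered \<open>u\<close> and \<open>w\<close>, the sets \<open>P\<close>
  and \<open>Q\<close> have at least n/2 - b - 2 elements, and typical vertices of either have at
  most \<open>b + 1\<close> neighbors in the other. Everything depends on whether
  \<open>P \<inter> Q\<close> contains a typical vertex. The value of \<open>a\<close> is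
  \<open>(b + 1) + (3 * b + 4)\<close>, where the second term bounds \<open>P - Q\<close> and
  \<open>Q - P\<close> in one case and the set of vertices outside \<open>P \<union> Q\<close> in
  the other.\<close>

lemma stability:
  assumes typical: "\<And>M. rainbow_matching E c M \<Longrightarrow> card {v \<in> V. b < card (bad E c M v)} \<le> b"
    and deg: "\<And>v. v \<in> V \<Longrightarrow> card V \<le> 2 * card (nbrs E v)"
    and n: "4 * b < card V" "even (card V)"
    and no: "\<nexists>M. rainbow_matching E c M \<and> \<Union>M = V"
    and a: "a = 4 * b + 5"
  shows "(\<exists>Y\<subseteq>V. card V \<le> 2 * card Y + a \<and> 2 * card Y \<le> card V + a \<and>
            card {y \<in> Y. a < card (nbrs E y \<inter> Y)} \<le> a) \<or>
         (\<exists>S\<subseteq>V. card V \<le> 2 * card S + a \<and> 2 * card S \<le> card V + a \<and>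
            card {y \<in> S. a < card (nbrs E y - S)} \<le> a \<and>
            card {y \<in> V - S. a < card (nbrs E y \<inter> S)} \<le> a)"
proof -
  obtain M0 where M0: "max_rainbow_matching E c M0" using max_rm_exists .
  then have rm0: "rainbow_matching E c M0" by (simp add: max_rainbow_matching_def)
  obtain u0 where u0: "u0 \<in> V" "u0 \<notin> \<Union>M0" using no rm0 rmD(5)[OF rm0] by blast
  have c0: "card (V - \<Union>M0) = card V - 2 * card M0"
    using card_Union_rm[OF rm0] rmD(5)[OF rm0] finite_V by (metis card_Diff_subset finite_subset)
  then have "even (card (V - \<Union>M0))" using n(2) by simp
  moreover have "card (V - \<Union>M0) \<noteq> 0" using u0 finite_V by auto
  ultimately have "\<not> card (V - \<Union>M0) \<le> Suc 0" by presburger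
  then obtain w0 where w0: "w0 \<in> V" "w0 \<notin> \<Union>M0" "u0 \<noteq> w0"
    using finite_V by (subst (asm) card_le_Suc0_iff_eq) (use u0 in blast)+
  have deg3: "card V + 2 * b < 3 * card (nbrs E v)" if "v \<in> V" for v
    using deg[OF that] n(1) by linarith
  obtain M u w where M: "max_rainbow_matching E c M" and u: "u \<notin> \<Union>M" and w: "w \<notin> \<Union>M"
    and uw: "u \<noteq> w" "u \<in> V" "w \<in> V" and bu: "card (bad E c M u) \<le> b + 2" and bw: "card (bad E c M w) \<le> b + 2"
    by (rule two_typical_uncovered[OF typical M0 u0(2,1) w0(2,1,3) edge_subset deg3])
  have rm: "rainbow_matching E c M" using M by (simp add: max_rainbow_matching_def)
  define P where "P = partner M ` good E c M u"
  define Q where "Q = partner M ` good E c M w"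
  have sub: "P \<subseteq> V" "Q \<subseteq> V"
    using partner(4)[OF rm] good_covered[OF M u] good_covered[OF M w] rmD(5)[OF rm]
    unfolding P_def Q_def by blast+
  have fin: "finite P" "finite Q" using sub finite_V finite_subset by auto
  have cP: "card P = card (good E c M u)" unfolding P_def by (rule card_partner_good[OF M u])
  have cQ: "card Q = card (good E c M w)" unfolding Q_def by (rule card_partner_good[OF M w])
  have gP: "card V \<le> 2 * card P + 2 * b + 4"
    using deg[OF uw(2)] card_good_bad[of u M] bu cP by linarith
  have gQ: "card V \<le> 2 * card Q + 2 * b + 4"
    using deg[OF uw(3)] card_good_bad[of w M] bw cQ by linarith
  have "good E c M u \<inter> Q = {}" using partner_good_disjoint[OF M w u] uw unfolding Q_def by blast
  then have "card (good E c M u) + card Q \<le> card V"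
    using sub fin finite_good[of M u] finite_V good_subset[of M u] nbrs_subset[of u]
    by (subst card_Un_disjoint[symmetric]) (blast intro: card_mono)+
  then have uQ: "2 * card Q \<le> card V + 2 * b + 4" using gP cP by linarith
  have PQ: "card (nbrs E y \<inter> Q) \<le> b + 1" if "y \<in> P" "card (bad E c M y) \<le> b" for y
    using card_partner_good_nbrs[OF M u w uw(1), of y] that unfolding P_def Q_def by linarith
  have QP: "card (nbrs E y \<inter> P) \<le> b + 1" if "y \<in> Q" "card (bad E c M y) \<le> b" for y
    using card_partner_good_nbrs[OF M w u uw(1)[symmetric], of y] that unfolding P_def Q_def by linarith
  let ?A = "{v \<in> V. b < card (bad E c M v)}"
  have A: "card ?A \<le> b" "finite ?A" using typical[OF rm] finite_V by auto
  have un: "card (P \<union> Q) + card (P \<inter> Q) = card P + card Q" using card_Un_Int[OF fin] by simp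
  show ?thesis
  proof (cases "\<exists>y\<in>P \<inter> Q. card (bad E c M y) \<le> b")
    case True
    then obtain y where y: "y \<in> P" "y \<in> Q" "card (bad E c M y) \<le> b" by blast
    \<comment> \<open>Nearly all neighbors of \<open>y\<close> lie outside
      \<open>P \<union> Q\<close>, which leaves this union only about n/2 vertices. Hence
      \<open>P\<close> and \<open>Q\<close> almost coincide.\<close>
    let ?Y = "P \<union> Q"
    have "nbrs E y \<inter> ?Y = (nbrs E y \<inter> P) \<union> (nbrs E y \<inter> Q)" by blast
    then have "card (nbrs E y \<inter> ?Y) \<le> 2 * b + 2"
      using PQ[OF y(1,3)] QP[OF y(2,3)] card_Un_le[of "nbrs E y \<inter> P" "nbrs E y \<inter> Q"] by simp
    moreover have "card (nbrs E y) = card (nbrs E y \<inter> ?Y) + card (nbrs E y - ?Y)"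
      using card_Int_Diff[OF finite_nbrs] by blast
    moreover have "card (nbrs E y - ?Y) \<le> card (V - ?Y)"
      using nbrs_subset finite_V by (intro card_mono) auto
    moreover have "card (V - ?Y) = card V - card ?Y" using sub fin by (intro card_Diff_subset) auto
    moreover have "card ?Y \<le> card V" using sub finite_V by (intro card_mono) auto
    moreover have "y \<in> V" using y sub by auto
    ultimately have Y: "2 * card ?Y \<le> card V + 4 * b + 4" using deg[of y] by linarith
    have "P - Q = ?Y - Q" "Q - P = ?Y - P" by blast+
    then have dP: "card (P - Q) = card ?Y - card Q" and dQ: "card (Q - P) = card ?Y - card P"
      using fin by (simp_all add: card_Diff_subset)
    have "card (nbrs E z \<inter> ?Y) \<le> a" if z: "z \<in> ?Y" "card (bad E c M z) \<le> b" for z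
    proof (cases "z \<in> P")
      case True
      have "card (nbrs E z \<inter> ?Y) \<le> card ((nbrs E z \<inter> Q) \<union> (P - Q))"
        using fin by (intro card_mono) auto
      also have "\<dots> \<le> card (nbrs E z \<inter> Q) + card (P - Q)" by (rule card_Un_le)
      finally show ?thesis using PQ[OF True z(2)] dP Y gQ a by linarith
    next
      case False
      have "card (nbrs E z \<inter> ?Y) \<le> card ((nbrs E z \<inter> P) \<union> (Q - P))"
        using fin by (intro card_mono) auto
      also have "\<dots> \<le> card (nbrs E z \<inter> P) + card (Q - P)" by (rule card_Un_le)
      finally show ?thesis using QP[of z] False z dQ Y gP a by auto
    qed
    then have "{y \<in> ?Y. a < card (nbrs E y \<inter> ?Y)} \<subseteq> ?A" using sub by force
    then have "card {y \<in> ?Y. a < card (nbrs E y \<inter> ?Y)} \<le> a"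
      using A(1) card_mono[OF A(2), of "{y \<in> ?Y. a < card (nbrs E y \<inter> ?Y)}"] a by linarith
    moreover have "card P \<le> card ?Y" using fin by (intro card_mono) auto
    ultimately show ?thesis using sub Y gP a by (intro disjI1 exI[of _ ?Y]) auto
  next
    case False
    then have "P \<inter> Q \<subseteq> ?A" using sub by force
    then have i: "card (P \<inter> Q) \<le> b" using A(1) card_mono[OF A(2), of "P \<inter> Q"] by linarith
    \<comment> \<open>This differs from \<open>P\<close> only by \<open>P \<inter> Q\<close> and the
      few vertices outside \<open>P \<union> Q\<close>; together with \<open>Q\<close> it partitions
      \<open>V\<close>.\<close>
    let ?S = "V - Q"
    have S: "card ?S = card V - card Q" "card Q \<le> card V"
      using sub fin finite_V by (auto simp: card_Diff_subset card_mono)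
    have r: "card (V - (P \<union> Q)) = card V - card (P \<union> Q)"
      using sub fin by (intro card_Diff_subset) auto
    have r': "card (V - (P \<union> Q)) \<le> 3 * b + 4" using r un i gP gQ by linarith
    have "{y \<in> ?S. a < card (nbrs E y - ?S)} \<subseteq> ?A \<union> (V - (P \<union> Q))"
    proof
      fix y assume y: "y \<in> {y \<in> ?S. a < card (nbrs E y - ?S)}"
      have "nbrs E y - ?S = nbrs E y \<inter> Q" using nbrs_subset sub by auto
      then show "y \<in> ?A \<union> (V - (P \<union> Q))" using y PQ[of y] a by fastforce
    qed
    then have "card {y \<in> ?S. a < card (nbrs E y - ?S)} \<le> card (?A \<union> (V - (P \<union> Q)))"
      using finite_V by (intro card_mono) auto
    then have 1: "card {y \<in> ?S. a < card (nbrs E y - ?S)} \<le> a"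
      using card_Un_le[of ?A "V - (P \<union> Q)"] A r' a by linarith
    have "{y \<in> V - ?S. a < card (nbrs E y \<inter> ?S)} \<subseteq> ?A"
    proof
      fix y assume y: "y \<in> {y \<in> V - ?S. a < card (nbrs E y \<inter> ?S)}"
      have "card (nbrs E y \<inter> ?S) \<le> card ((nbrs E y \<inter> P) \<union> (V - (P \<union> Q)))"
        using fin finite_V by (intro card_mono) auto
      also have "\<dots> \<le> card (nbrs E y \<inter> P) + card (V - (P \<union> Q))" by (rule card_Un_le)
      finally have "card (nbrs E y \<inter> ?S) \<le> card (nbrs E y \<inter> P) + (3 * b + 4)" using r' by linarith
      then show "y \<in> ?A" using y QP[of y] a by fastforce
    qed
    then have 2: "card {y \<in> V - ?S. a < card (nbrs E y \<inter> ?S)} \<le> a"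
      using A(1) card_mono[OF A(2), of "{y \<in> V - ?S. a < card (nbrs E y \<inter> ?S)}"] a by linarith
    have "card V \<le> 2 * card ?S + a" "2 * card ?S \<le> card V + a" using S uQ gQ a by linarith+
    then show ?thesis using 1 2 by (intro disjI2 exI[of _ ?S]) auto
  qed
qed

end

section \<open>Extremal cases\<close>

lemma rainbow_matching_supergraph:
  "rainbow_matching E' c M \<Longrightarrow> E' \<subseteq> E \<Longrightarrow> rainbow_matching E c M"
  by (auto simp: rainbow_matching_def matching_def)

lemma bad_subgraph: "E' \<subseteq> E \<Longrightarrow> bad E' c M v \<subseteq> bad E c M v"
  by (auto simp: bad_def nbrs_def)

context strong_graph
begin

lemma complete_residual:
  assumes N: "rainbow_matching E c N" and E': "E' \<subseteq> {e \<in> E. c e \<notin> c ` N}"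
    and M: "rainbow_matching E' c M" "\<Union>M = V - \<Union>N"
  shows "\<exists>M. rainbow_matching E c M \<and> \<Union>M = V"
proof (intro exI conjI)
  have M': "rainbow_matching E c M" using E' by (intro rainbow_matching_supergraph[OF M(1)]) auto
  have col: "c e \<noteq> c f" if "e \<in> M" "f \<in> N" for e f
    using that M(1) E' by (fastforce simp: rainbow_matching_def matching_def)
  show "rainbow_matching E c (M \<union> N)"
  proof (rule rmI)
    show "M \<union> N \<subseteq> E" using rmD(1)[OF M'] rmD(1)[OF N] by blast
    show "e = f" if "e \<in> M \<union> N" "f \<in> M \<union> N" "x \<in> e" "x \<in> f" for e f x
      using that rmD(2)[OF M', of e f x] rmD(2)[OF N, of e f x] M(2) by blast
    show "inj_on c (M \<union> N)"
      using rmD(3)[OF M'] rmD(3)[OF N] col by (auto simp: inj_on_Un dest: col)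
  qed
  show "\<Union>(M \<union> N) = V" using M(2) rmD(5)[OF N] by auto
qed

text \<open>The matching \<open>N\<close> covers \<open>2 * card N\<close> vertices, and each of its
  colors occurs on at most one edge at \<open>v\<close>.\<close>

lemma card_residual_nbrs:
  assumes N: "rainbow_matching E c N"
  shows "card (nbrs E v \<inter> A) \<le> card ((nbrs E v \<inter> A) - \<Union>N - bad E c N v) + 3 * card N"
proof -
  let ?R = "(nbrs E v \<inter> A) - \<Union>N - bad E c N v"
  have fin: "finite (\<Union>N)" using rmD(5)[OF N] finite_V finite_subset by blast
  have "card (nbrs E v \<inter> A) \<le> card (?R \<union> (\<Union>N \<union> bad E c N v))"
    using finite_nbrs finite_bad fin by (intro card_mono) auto
  also have "\<dots> \<le> card ?R + (card (\<Union>N) + card (bad E c N v))"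
    by (meson card_Un_le add_left_mono order_trans)
  finally show ?thesis using card_Union_rm[OF N] card_bad_le[OF N, of v] by linarith
qed

lemma near_bipartite_assigned:
  assumes V: "V = (X \<union> Z1) \<union> (Y \<union> Z2)" and disj: "(X \<union> Z1) \<inter> (Y \<union> Z2) = {}" "X \<inter> Z1 = {}" "Y \<inter> Z2 = {}"
    and deg: "\<And>v. v \<in> V \<Longrightarrow> card V \<le> 2 * card (nbrs E v)"
    and even: "even (card V)" "card V > 0" and le: "card (X \<union> Z1) \<le> card (Y \<union> Z2)"
    and size: "200 * card X \<le> 101 * card V" "200 * card Y \<le> 101 * card V" "1000 * card (Z1 \<union> Z2) \<le> card V"
    and dX: "\<And>v. v \<in> X \<Longrightarrow> 48 * card V \<le> 100 * card (nbrs E v \<inter> Y)"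
    and dY: "\<And>v. v \<in> Y \<Longrightarrow> 48 * card V \<le> 100 * card (nbrs E v \<inter> X)"
    and dZ1: "\<And>v. v \<in> Z1 \<Longrightarrow> card V \<le> 5 * card (nbrs E v \<inter> Y)"
    and dZ2: "\<And>v. v \<in> Z2 \<Longrightarrow> card V \<le> 5 * card (nbrs E v \<inter> X)"
  shows "\<exists>M. rainbow_matching E c M \<and> \<Union>M = V"
proof -
  let ?n = "card V" and ?X = "X \<union> Z1" and ?Y = "Y \<union> Z2" and ?Z = "Z1 \<union> Z2"
  have fin: "finite X" "finite Y" "finite Z1" "finite Z2" using V finite_V by auto
  have n: "?n = card ?X + card ?Y" using V disj fin by (simp add: card_Un_disjoint)
  define d where "d = (card ?Y - card ?X) div 2"
  have d: "card ?Y = card ?X + 2 * d" using n even le unfolding d_def by presburger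
  have cY: "card ?Y \<le> card Y + card ?Z"
    using card_Un_le[of Y Z2] card_mono[of ?Z Z2] fin by auto
  have dsmall: "1000 * d \<le> 6 * ?n" using n d cY size by linarith
  let ?E1 = "{e \<in> E. e \<subseteq> ?Y}"
  interpret A: strong_graph ?Y ?E1 c using V by (intro subgraph) auto
  \<comment> \<open>The exact degree condition: \<open>v\<close> has at least n/2 neighbors, but the
    smaller side has only n/2 - d vertices.\<close>
  have "d \<le> card (nbrs ?E1 v)" if v: "v \<in> ?Y" for v
  proof -
    have "nbrs E v \<subseteq> nbrs ?E1 v \<union> ?X" using nbrs_subset[of v] V v by (auto simp: nbrs_def)
    then have "card (nbrs E v) \<le> card (nbrs ?E1 v \<union> ?X)" using fin A.finite_nbrs by (intro card_mono) auto
    also have "\<dots> \<le> card (nbrs ?E1 v) + card ?X" by (rule card_Un_le)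
    finally show ?thesis using deg[of v] v V n d by simp
  qed
  moreover have "3 * d \<le> card ?Y" using n d dsmall by linarith
  ultimately obtain N where N1: "rainbow_matching ?E1 c N" and cN: "card N = d"
    by (rule A.rainbow_matching_of_size_min_degree)
  have N: "rainbow_matching E c N" by (rule rainbow_matching_supergraph[OF N1]) auto
  have NY: "\<Union>N \<subseteq> ?Y" by (rule A.rmD(5)[OF N1])
  define R where "R z = (if z \<in> Z1 then nbrs E z \<inter> Y else nbrs E z \<inter> X)" for z
  have cZ: "card (?Z - \<Union>N) \<le> card ?Z" using fin by (intro card_mono) auto
  have "\<exists>N'. rainbow_matching E c N' \<and> N \<subseteq> N' \<and> ?Z - \<Union>N \<subseteq> \<Union>N' \<and> card N' = card N + card (?Z - \<Union>N) \<and>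
    (\<forall>e\<in>N' - N. \<exists>z\<in>?Z - \<Union>N. \<exists>x\<in>R z. e = {z, x})"
  proof (rule greedy_extend[OF _ N])
    fix z assume z: "z \<in> ?Z - \<Union>N"
    have "?n \<le> 5 * card (R z)" using z dZ1 dZ2 by (auto simp: R_def)
    then have "3 * (card N + card (?Z - \<Union>N)) \<le> card (R z)" using cN dsmall cZ size(3) unfolding distrib_left by linarith
    then show "R z \<subseteq> nbrs E z \<and> R z \<inter> (?Z - \<Union>N) = {} \<and> 3 * (card N + card (?Z - \<Union>N)) \<le> card (R z)"
      using disj by (auto simp: R_def)
  qed (use fin in auto)
  then obtain N' where N': "rainbow_matching E c N'" "N \<subseteq> N'" "?Z - \<Union>N \<subseteq> \<Union>N'"
    "card N' = card N + card (?Z - \<Union>N)" "\<forall>e\<in>N' - N. \<exists>z\<in>?Z - \<Union>N. \<exists>x\<in>R z. e = {z, x}" by blast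
  let ?D = "N' - N"
  have D: "rainbow_matching E c ?D" by (rule rm_mono[OF N'(1)]) auto
  have sides: "\<exists>x\<in>?X. \<exists>y\<in>?Y. e = {x, y}" if eD: "e \<in> ?D" for e
  proof -
    obtain z x where zx: "z \<in> ?Z" "x \<in> R z" "e = {z, x}" using bspec[OF N'(5) eD] by blast
    show ?thesis
    proof (cases "z \<in> Z1")
      case True
      then show ?thesis using zx by (auto simp: R_def)
    next
      case False
      then have "x \<in> ?X" "z \<in> ?Y" "e = {x, z}" using zx by (auto simp: R_def)
      then show ?thesis by blast
    qed
  qed
  note cD = card_covered_sides[OF D disj(1) sides]
  have UN: "\<Union>N' = \<Union>N \<union> \<Union>?D" "\<Union>N \<inter> \<Union>?D = {}"
    using N'(2) rmD(2)[OF N'(1)] by blast+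
  let ?X' = "?X - \<Union>N'" and ?Y' = "?Y - \<Union>N'"
  have fU: "finite (\<Union>N')" "finite (\<Union>N)" using rmD(5)[OF N'(1)] rmD(5)[OF N] finite_V finite_subset by blast+
  have "?X' = ?X - (\<Union>?D \<inter> ?X)" using UN NY disj by blast
  then have cX': "card ?X' = card ?X - card ?D"
    using cD fin fU by (simp add: card_Diff_subset)
  have "?Y' = ?Y - (\<Union>N \<union> (\<Union>?D \<inter> ?Y))" using UN by blast
  moreover have "card (\<Union>N \<union> (\<Union>?D \<inter> ?Y)) = 2 * d + card ?D"
    using card_Union_rm[OF N] cN cD UN fU fin by (subst card_Un_disjoint) auto
  ultimately have cY': "card ?Y' = card ?Y - (2 * d + card ?D)"
    using fin fU NY by (simp add: card_Diff_subset)
  define k where "k = card ?X'"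
  have k: "card ?X' = k" "card ?Y' = k" using cX' cY' d by (auto simp: k_def)
  have sub: "?X' \<subseteq> X" "?Y' \<subseteq> Y" using N'(3) UN by blast+
  have k_le: "200 * k \<le> 101 * ?n" using card_mono[OF fin(1) sub(1)] size(1) k by linarith
  have cN': "1000 * card N' \<le> 7 * ?n" using N'(4) cN dsmall cZ size(3) by linarith
  let ?E2 = "{e \<in> E. (\<exists>x\<in>?X'. \<exists>y\<in>?Y'. e = {x, y}) \<and> c e \<notin> c ` N'}"
  interpret B: strong_graph "?X' \<union> ?Y'" ?E2 c using V by (intro subgraph) auto
  \<comment> \<open>At least 0.48n - 3 * 0.007n neighbors survive, while \<open>k\<close> is at most
    0.505n.\<close>
  have "3 * k < 4 * card (nbrs ?E2 v)" if v: "v \<in> ?X' \<union> ?Y'" for v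
  proof -
    have "\<exists>A. 48 * ?n \<le> 100 * card (nbrs E v \<inter> A) \<and> (nbrs E v \<inter> A) - \<Union>N' - bad E c N' v \<subseteq> nbrs ?E2 v"
    proof (cases "v \<in> ?X'")
      case True
      have "nbrs E v \<inter> Y - \<Union>N' - bad E c N' v \<subseteq> nbrs ?E2 v"
      proof
        fix y assume y: "y \<in> nbrs E v \<inter> Y - \<Union>N' - bad E c N' v"
        then have "{v, y} \<in> E" "c {v, y} \<notin> c ` N'" "y \<in> ?Y'" by (auto simp: nbrs_def bad_def)
        then show "y \<in> nbrs ?E2 v" using True unfolding nbrs_def by blast
      qed
      then show ?thesis using dX[of v] sub(1) True by blast
    next
      case False
      then have v': "v \<in> ?Y'" using v by blast
      have "nbrs E v \<inter> X - \<Union>N' - bad E c N' v \<subseteq> nbrs ?E2 v"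
      proof
        fix y assume y: "y \<in> nbrs E v \<inter> X - \<Union>N' - bad E c N' v"
        then have "{v, y} \<in> E" "c {v, y} \<notin> c ` N'" "y \<in> ?X'" by (auto simp: nbrs_def bad_def)
        moreover have "{v, y} = {y, v}" by (rule insert_commute)
        ultimately show "y \<in> nbrs ?E2 v" using v' unfolding nbrs_def by blast
      qed
      then show ?thesis using dY[of v] sub(2) v' by blast
    qed
    then obtain A where A: "48 * ?n \<le> 100 * card (nbrs E v \<inter> A)"
      "(nbrs E v \<inter> A) - \<Union>N' - bad E c N' v \<subseteq> nbrs ?E2 v" by blast
    have "card ((nbrs E v \<inter> A) - \<Union>N' - bad E c N' v) \<le> card (nbrs ?E2 v)"
      by (rule card_mono[OF B.finite_nbrs A(2)])
    then show ?thesis using card_residual_nbrs[OF N'(1), of v A] A(1) k_le cN' even(2) by linarith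
  qed
  note degB = this
  have disj': "?X' \<inter> ?Y' = {}" using disj by blast
  have sidesB: "\<exists>x\<in>?X'. \<exists>y\<in>?Y'. e = {x, y}" if "e \<in> ?E2" for e using that by blast
  obtain M where M: "rainbow_matching ?E2 c M" "\<Union>M = ?X' \<union> ?Y'"
    by (rule B.perfect_near_complete_bipartite[OF refl disj' k sidesB degB])
  have "?X' \<union> ?Y' = V - \<Union>N'" using V by blast
  then show ?thesis using complete_residual[OF N'(1) _ M(1)] M(2) by fastforce
qed

lemma near_bipartite:
  assumes V: "V = X \<union> Y \<union> Z" and disj: "X \<inter> Y = {}" "X \<inter> Z = {}" "Y \<inter> Z = {}"
    and deg: "\<And>v. v \<in> V \<Longrightarrow> card V \<le> 2 * card (nbrs E v)"
    and even: "even (card V)" "card V > 0"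
    and size: "200 * card X \<le> 101 * card V" "200 * card Y \<le> 101 * card V" "1000 * card Z \<le> card V"
    and dX: "\<And>v. v \<in> X \<Longrightarrow> 48 * card V \<le> 100 * card (nbrs E v \<inter> Y)"
    and dY: "\<And>v. v \<in> Y \<Longrightarrow> 48 * card V \<le> 100 * card (nbrs E v \<inter> X)"
  shows "\<exists>M. rainbow_matching E c M \<and> \<Union>M = V"
proof -
  \<comment> \<open>An exceptional vertex joins the side opposite to many of its neighbors. One with
    fewer than n/5 neighbors in \<open>Y\<close> has at least n/2 - n/5 - n/1000 in
    \<open>X\<close>.\<close>
  define Z1 where "Z1 = {z \<in> Z. card V \<le> 5 * card (nbrs E z \<inter> Y)}"
  define Z2 where "Z2 = Z - Z1"
  have Z: "Z1 \<union> Z2 = Z" "Z1 \<inter> Z2 = {}" "Z1 \<subseteq> Z" "Z2 \<subseteq> Z" "finite Z" using V finite_V by (auto simp: Z1_def Z2_def)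
  have dZ1: "card V \<le> 5 * card (nbrs E v \<inter> Y)" if "v \<in> Z1" for v using that by (simp add: Z1_def)
  have dZ2: "card V \<le> 5 * card (nbrs E v \<inter> X)" if v: "v \<in> Z2" for v
  proof -
    have "nbrs E v = (nbrs E v \<inter> X) \<union> (nbrs E v \<inter> Y) \<union> (nbrs E v \<inter> Z)" using nbrs_subset V by blast
    then have "card (nbrs E v) \<le> card (nbrs E v \<inter> X) + card (nbrs E v \<inter> Y) + card (nbrs E v \<inter> Z)"
      by (metis (no_types, lifting) card_Un_le add_le_mono1 order_trans)
    moreover have "card (nbrs E v \<inter> Z) \<le> card Z" using Z by (intro card_mono) auto
    moreover have "5 * card (nbrs E v \<inter> Y) < card V" "v \<in> V" using v V by (auto simp: Z1_def Z2_def)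
    ultimately show ?thesis using deg[of v] size(3) by linarith
  qed
  show ?thesis
  proof (cases "card (X \<union> Z1) \<le> card (Y \<union> Z2)")
    case True
    show ?thesis
      by (rule near_bipartite_assigned[of X Z1 Y Z2])
        (use V Z disj deg even True size dX dY dZ1 dZ2 in auto)
  next
    case False
    show ?thesis
      by (rule near_bipartite_assigned[of Y Z2 X Z1])
        (use V Z disj deg even False size dX dY dZ1 dZ2 in \<open>auto simp: Un_commute\<close>)
  qed
qed

text \<open>Most vertices of \<open>Y\<close> send almost n/2 edges to \<open>X\<close>, so the pair
  \<open>X\<close>, \<open>Y\<close> has nearly all possible edges, and only few vertices of
  \<open>X\<close> can miss a noticeable part of \<open>Y\<close>. These, and the vertices of
  \<open>Y\<close> with many neighbors inside \<open>Y\<close>, are the exceptional ones.\<close>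

lemma near_independent_half:
  assumes deg: "\<And>v. v \<in> V \<Longrightarrow> card V \<le> 2 * card (nbrs E v)" and even: "even (card V)"
    and a: "0 < a" "400000 * a \<le> card V"
    and Y: "Y \<subseteq> V" "card V \<le> 2 * card Y + a" "2 * card Y \<le> card V + a" "card {y \<in> Y. a < card (nbrs E y \<inter> Y)} \<le> a"
  shows "\<exists>M. rainbow_matching E c M \<and> \<Union>M = V"
proof -
  let ?n = "card V"
  define X where "X = V - Y"
  define Y0 where "Y0 = {y \<in> Y. card (nbrs E y \<inter> Y) \<le> a}"
  define X0 where "X0 = {x \<in> X. 49 * ?n \<le> 100 * card (nbrs E x \<inter> Y)}"
  have fin: "finite X" "finite Y" using Y finite_V finite_subset by (auto simp: X_def)
  have cX: "card X + card Y = ?n"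
    using Y finite_V fin card_mono[OF finite_V Y(1)] by (simp add: X_def card_Diff_subset)
  have sub: "X0 \<subseteq> X" "Y0 \<subseteq> Y" by (auto simp: X0_def Y0_def)
  have cY0: "card (Y - Y0) \<le> a"
  proof -
    have "Y - Y0 = {y \<in> Y. a < card (nbrs E y \<inter> Y)}" by (auto simp: Y0_def)
    then show ?thesis using Y(4) by simp
  qed
  have split: "card (nbrs E v) = card (nbrs E v \<inter> X) + card (nbrs E v \<inter> Y)" for v
  proof -
    have "nbrs E v = (nbrs E v \<inter> X) \<union> (nbrs E v \<inter> Y)" using nbrs_subset by (auto simp: X_def)
    moreover have "(nbrs E v \<inter> X) \<inter> (nbrs E v \<inter> Y) = {}" by (auto simp: X_def)
    ultimately show ?thesis using fin by (metis card_Un_disjoint finite_Int)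
  qed
  have dY0: "?n \<le> 2 * card (nbrs E v \<inter> X) + 2 * a" if "v \<in> Y0" for v
    using that deg[of v] split[of v] Y(1) by (auto simp: Y0_def)
  \<comment> \<open>Edges between \<open>X\<close> and \<open>Y\<close> are counted from both sides.
    The degrees in \<open>Y0\<close> allow a deficit of at most \<open>5 / 2 * (r * n)\<close>,
    whereas each vertex of \<open>X - X0\<close> contributes a deficit of at least 9n/1000. The
    factor 300 turns this into \<open>27 / 10 * (r * n)\<close>, which is too much.\<close>
  have cX0: "card (X - X0) \<le> 300 * a"
  proof (rule ccontr)
    assume big: "\<not> card (X - X0) \<le> 300 * a"
    have "(\<Sum>x\<in>X. card (nbrs E x \<inter> Y)) = (\<Sum>x\<in>X. \<Sum>y\<in>Y. if {x, y} \<in> E then 1 else 0)"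
      using fin by (intro sum.cong refl) (simp add: sum.If_cases nbrs_def Int_commute Collect_conj_eq Collect_mem_eq)
    also have "\<dots> = (\<Sum>y\<in>Y. \<Sum>x\<in>X. if {x, y} \<in> E then 1 else 0)" by (rule sum.swap)
    also have "\<dots> = (\<Sum>y\<in>Y. card (nbrs E y \<inter> X))"
      using fin by (intro sum.cong refl)
        (simp add: sum.If_cases nbrs_def Int_commute Collect_conj_eq Collect_mem_eq insert_commute)
    finally have dc: "(\<Sum>x\<in>X. card (nbrs E x \<inter> Y)) = (\<Sum>y\<in>Y. card (nbrs E y \<inter> X))" .
    define n p q b r where "n = real ?n" and "p = real (card Y)" and "q = real (card X)"
      and "b = real (card (X - X0))" and "r = real a"
    have lo: "(p - r) * (n / 2 - r) \<le> real (\<Sum>y\<in>Y. card (nbrs E y \<inter> X))"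
    proof -
      have "p - r \<le> card Y0"
        using cY0 fin sub card_Diff_subset[of Y0 Y] card_mono[OF fin(2) sub(2)] finite_subset[OF sub(2)]
        by (simp add: p_def r_def)
      then have "(p - r) * (n / 2 - r) \<le> card Y0 * (n / 2 - r)"
        using a by (intro mult_right_mono) (auto simp: n_def r_def)
      also have "\<dots> = (\<Sum>y\<in>Y0. n / 2 - r)" by simp
      also have "\<dots> \<le> (\<Sum>y\<in>Y0. real (card (nbrs E y \<inter> X)))"
      proof (rule sum_mono)
        fix y assume "y \<in> Y0"
        then have "real ?n \<le> real (2 * card (nbrs E y \<inter> X) + 2 * a)" using dY0 of_nat_mono by blast
        then show "n / 2 - r \<le> real (card (nbrs E y \<inter> X))" by (simp add: n_def r_def)
      qed
      also have "\<dots> \<le> (\<Sum>y\<in>Y. real (card (nbrs E y \<inter> X)))" using fin sub by (intro sum_mono2) auto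
      finally show ?thesis by simp
    qed
    have hi: "real (\<Sum>x\<in>X. card (nbrs E x \<inter> Y)) \<le> b * (49 / 100 * n) + (q - b) * p"
    proof -
      have "real (\<Sum>x\<in>X. card (nbrs E x \<inter> Y)) = (\<Sum>x\<in>X - X0. real (card (nbrs E x \<inter> Y))) + (\<Sum>x\<in>X0. real (card (nbrs E x \<inter> Y)))"
        using sum.subset_diff[OF sub(1) fin(1), of "\<lambda>x. real (card (nbrs E x \<inter> Y))"] by simp
      also have "\<dots> \<le> (\<Sum>x\<in>X - X0. 49 / 100 * n) + (\<Sum>x\<in>X0. p)"
      proof (intro add_mono sum_mono)
        fix x assume "x \<in> X - X0"
        then have "100 * card (nbrs E x \<inter> Y) < 49 * ?n" by (auto simp: X0_def)
        then have "real (100 * card (nbrs E x \<inter> Y)) < real (49 * ?n)" by (simp only: of_nat_less_iff)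
        then show "real (card (nbrs E x \<inter> Y)) \<le> 49 / 100 * n" by (simp add: n_def)
      next
        fix x assume "x \<in> X0"
        show "real (card (nbrs E x \<inter> Y)) \<le> p" using fin by (auto simp: p_def intro: card_mono)
      qed
      also have "\<dots> = b * (49 / 100 * n) + card X0 * p" by (simp add: b_def)
      also have "real (card X0) = q - b"
        using fin sub card_Diff_subset[of X0 X] card_mono[OF fin(1) sub(1)] finite_subset[OF sub(1)]
        by (simp add: b_def q_def)
      finally show ?thesis .
    qed
    have ineq: "(p - r) * (n / 2 - r) \<le> b * (49 / 100 * n) + (q - b) * p" using lo hi dc by simp
    have r: "0 < r" "400000 * r \<le> n" "n \<le> 2 * p + r" "2 * p \<le> n + r" "300 * r \<le> b" "q = n - p"
      using a Y(2,3) big cX by (simp_all add: n_def p_def q_def r_def b_def)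
    have "b * (p - 49 / 100 * n) \<le> p * (q - n / 2 + r) + r * (n / 2 - r)"
      using ineq by (simp add: algebra_simps diff_divide_distrib)
    also have "\<dots> \<le> n * (3 / 2 * r) + r * n"
    proof (rule add_mono)
      show "p * (q - n / 2 + r) \<le> n * (3 / 2 * r)"
        using r by (intro mult_mono) auto
      show "r * (n / 2 - r) \<le> r * n" using r by (intro mult_left_mono) auto
    qed
    finally have 1: "b * (p - 49 / 100 * n) \<le> 5 / 2 * (r * n)" by (simp add: algebra_simps)
    have "300 * r * (9 / 1000 * n) \<le> b * (p - 49 / 100 * n)"
      using r by (intro mult_mono) auto
    moreover have "300 * r * (9 / 1000 * n) = 27 / 10 * (r * n)" by simp
    ultimately have "27 / 10 * (r * n) \<le> 5 / 2 * (r * n)" using 1 by linarith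
    moreover have "0 < r * n" using r by simp
    ultimately show False by linarith
  qed
  let ?Z = "(X - X0) \<union> (Y - Y0)"
  have cZ: "card ?Z \<le> 301 * a" using card_Un_le[of "X - X0" "Y - Y0"] cX0 cY0 by linarith
  show ?thesis
  proof (rule near_bipartite[of X0 Y0 ?Z])
    show "V = X0 \<union> Y0 \<union> ?Z" using sub Y(1) by (auto simp: X_def)
    show "X0 \<inter> Y0 = {}" "X0 \<inter> ?Z = {}" "Y0 \<inter> ?Z = {}" using sub by (auto simp: X_def)
    show "200 * card X0 \<le> 101 * ?n" using card_mono[OF fin(1) sub(1)] cX Y a by linarith
    show "200 * card Y0 \<le> 101 * ?n" using card_mono[OF fin(2) sub(2)] cX Y a by linarith
    show "1000 * card ?Z \<le> ?n" using cZ a by linarith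
    show "48 * ?n \<le> 100 * card (nbrs E v \<inter> Y0)" if v: "v \<in> X0" for v
    proof -
      have "card (nbrs E v \<inter> Y) \<le> card ((nbrs E v \<inter> Y0) \<union> (Y - Y0))"
        using fin sub finite_nbrs by (intro card_mono) auto
      also have "\<dots> \<le> card (nbrs E v \<inter> Y0) + card (Y - Y0)" by (rule card_Un_le)
      finally show ?thesis using cY0 a v by (simp add: X0_def)
    qed
    show "48 * ?n \<le> 100 * card (nbrs E v \<inter> X0)" if v: "v \<in> Y0" for v
    proof -
      have "card (nbrs E v \<inter> X) \<le> card ((nbrs E v \<inter> X0) \<union> (X - X0))"
        using fin sub finite_nbrs by (intro card_mono) auto
      also have "\<dots> \<le> card (nbrs E v \<inter> X0) + card (X - X0)" by (rule card_Un_le)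
      finally show ?thesis using cX0 a dY0[OF v] by linarith
    qed
  qed (use deg even a in auto)
qed

text \<open>Distributing the exceptional vertices over the two near-cliques may make both sides odd;
  a single crossing edge repairs this. The greedy edges stay inside a side and so keep the parity,
  and the residual graph drops all crossing edges.\<close>

lemma near_cliques:
  assumes deg: "\<And>v. v \<in> V \<Longrightarrow> card V \<le> 2 * card (nbrs E v)" and even: "even (card V)"
    and typical: "\<And>M. rainbow_matching E c M \<Longrightarrow> card {v \<in> V. b < card (bad E c M v)} \<le> b"
    and a: "b \<le> a" "5 \<le> a" "400 * a \<le> card V"
    and S: "S \<subseteq> V" "card V \<le> 2 * card S + a" "2 * card S \<le> card V + a"
      "card {y \<in> S. a < card (nbrs E y - S)} \<le> a" "card {y \<in> V - S. a < card (nbrs E y \<inter> S)} \<le> a"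
  shows "\<exists>M. rainbow_matching E c M \<and> \<Union>M = V"
proof -
  let ?n = "card V"
  define T where "T = V - S"
  define S0 where "S0 = {y \<in> S. card (nbrs E y - S) \<le> a}"
  define T0 where "T0 = {y \<in> T. card (nbrs E y \<inter> S) \<le> a}"
  have fin: "finite S" "finite T" using S finite_V finite_subset by (auto simp: T_def)
  have cT: "card T + card S = ?n"
    using S finite_V fin card_mono[OF finite_V S(1)] by (simp add: T_def card_Diff_subset)
  have sub: "S0 \<subseteq> S" "T0 \<subseteq> T" "S \<inter> T = {}" by (auto simp: S0_def T0_def T_def)
  have "S - S0 = {y \<in> S. a < card (nbrs E y - S)}" "T - T0 = {y \<in> V - S. a < card (nbrs E y \<inter> S)}"
    by (auto simp: S0_def T0_def T_def)
  then have rest: "card (S - S0) \<le> a" "card (T - T0) \<le> a" using S(4,5) by simp_all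
  define Z where "Z = (S - S0) \<union> (T - T0)"
  have finZ: "finite Z" using fin by (simp add: Z_def)
  have cZ: "card Z \<le> 2 * a" using card_Un_le[of "S - S0" "T - T0"] rest by (simp add: Z_def)
  have VZ: "V = S0 \<union> T0 \<union> Z" "S0 \<inter> Z = {}" "T0 \<inter> Z = {}" using sub S(1) by (auto simp: Z_def T_def)
  have dS0: "?n \<le> 2 * card (nbrs E v \<inter> S0) + 4 * a" if v: "v \<in> S0" for v
  proof -
    have "card (nbrs E v) \<le> card ((nbrs E v \<inter> S0) \<union> ((S - S0) \<union> (nbrs E v - S)))"
      using fin finite_nbrs by (intro card_mono) auto
    also have "\<dots> \<le> card (nbrs E v \<inter> S0) + (card (S - S0) + card (nbrs E v - S))"
      by (meson card_Un_le add_left_mono order_trans)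
    finally show ?thesis using v deg[of v] S(1) rest(1) by (auto simp: S0_def)
  qed
  have dT0: "?n \<le> 2 * card (nbrs E v \<inter> T0) + 4 * a" if v: "v \<in> T0" for v
  proof -
    have "card (nbrs E v) \<le> card ((nbrs E v \<inter> T0) \<union> ((T - T0) \<union> (nbrs E v \<inter> S)))"
      using fin finite_nbrs nbrs_subset[of v] by (intro card_mono) (auto simp: T_def)
    also have "\<dots> \<le> card (nbrs E v \<inter> T0) + (card (T - T0) + card (nbrs E v \<inter> S))"
      by (meson card_Un_le add_left_mono order_trans)
    finally show ?thesis using v deg[of v] sub(2) rest(2) by (auto simp: T0_def T_def)
  qed
  define Z1 where "Z1 = {z \<in> Z. ?n \<le> 5 * card (nbrs E z \<inter> S0)}"
  define Z2 where "Z2 = Z - Z1"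
  have Z: "Z1 \<union> Z2 = Z" "Z1 \<inter> Z2 = {}" by (auto simp: Z1_def Z2_def)
  have dZ2: "?n \<le> 5 * card (nbrs E v \<inter> T0)" if v: "v \<in> Z2" for v
  proof -
    have "card (nbrs E v) \<le> card ((nbrs E v \<inter> S0) \<union> ((nbrs E v \<inter> T0) \<union> Z))"
      using nbrs_subset VZ(1) finite_nbrs finZ by (intro card_mono) auto
    also have "\<dots> \<le> card (nbrs E v \<inter> S0) + (card (nbrs E v \<inter> T0) + card Z)"
      by (meson card_Un_le add_left_mono order_trans)
    finally have "card (nbrs E v) \<le> card (nbrs E v \<inter> S0) + (card (nbrs E v \<inter> T0) + card Z)" .
    moreover have "5 * card (nbrs E v \<inter> S0) < ?n" "v \<in> V" using v VZ by (auto simp: Z1_def Z2_def)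
    ultimately show ?thesis using deg[of v] cZ a by linarith
  qed
  let ?S = "S0 \<union> Z1" and ?T = "T0 \<union> Z2"
  have ST: "V = ?S \<union> ?T" "?S \<inter> ?T = {}" using VZ Z sub by blast+
  have fin': "finite ?S" "finite ?T" using ST finite_V by auto
  have cST: "card ?S + card ?T = ?n" using ST fin' by (simp add: card_Un_disjoint)
  have "\<exists>N. rainbow_matching E c N \<and> card N \<le> 1 \<and> even (card (?S - \<Union>N)) \<and> even (card (?T - \<Union>N))"
  proof (cases "even (card ?S)")
    case True
    then have "even (card ?T)" using cST even by presburger
    then show ?thesis using True rm_empty by (intro exI[of _ "{}"]) auto
  next
    case odd: False
    \<comment> \<open>A vertex of a set with at most n/2 vertices has at most n/2 - 1 neighbors
      inside, one less than its degree requires. Oddness ensures that the set is nonempty.\<close>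
    have leave: "\<exists>x\<in>A. \<exists>y\<in>B. {x, y} \<in> E" if AB: "V = A \<union> B" "finite A" "2 * card A \<le> ?n" "odd (card A)" for A B
    proof (rule ccontr)
      assume none: "\<not> (\<exists>x\<in>A. \<exists>y\<in>B. {x, y} \<in> E)"
      obtain x where x: "x \<in> A" using AB(4) by fastforce
      have "nbrs E x \<subset> A" using none x nbrs_subset[of x] AB(1) edge_neq[of x x] by (auto simp: nbrs_def)
      then have "card (nbrs E x) < card A" using AB(2) by (intro psubset_card_mono)
      then show False using deg[of x] x AB by auto
    qed
    have oddT: "odd (card ?T)" using odd cST even by presburger
    have "\<exists>x\<in>?S. \<exists>y\<in>?T. {x, y} \<in> E"
    proof (cases "2 * card ?S \<le> ?n")
      case True
      then show ?thesis using leave[OF ST(1) fin'(1) True odd] by blast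
    next
      case False
      then have "2 * card ?T \<le> ?n" using cST by linarith
      moreover have "V = ?T \<union> ?S" using ST by blast
      ultimately have "\<exists>y\<in>?T. \<exists>x\<in>?S. {y, x} \<in> E" using leave[OF _ fin'(2) _ oddT] by blast
      then show ?thesis by (metis insert_commute)
    qed
    then obtain x y where xy: "x \<in> ?S" "y \<in> ?T" "{x, y} \<in> E" by blast
    have "rainbow_matching E c {{x, y}}" using rm_insert(1)[OF rm_empty xy(3)] by simp
    moreover have "?S - \<Union>{{x, y}} = ?S - {x}" "?T - \<Union>{{x, y}} = ?T - {y}" using xy ST(2) by blast+
    moreover have "even (card (?S - {x}))" "even (card (?T - {y}))"
      using xy odd oddT fin' by (simp_all add: card_Diff_singleton)
    ultimately show ?thesis by (intro exI[of _ "{{x, y}}"]) simp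
  qed
  then obtain N where N: "rainbow_matching E c N" "card N \<le> 1" "even (card (?S - \<Union>N))" "even (card (?T - \<Union>N))"
    by blast
  define R where "R z = (if z \<in> Z1 then nbrs E z \<inter> S0 else nbrs E z \<inter> T0)" for z
  have cZ': "card (Z - \<Union>N) \<le> card Z" using finZ by (intro card_mono) auto
  have "\<exists>N'. rainbow_matching E c N' \<and> N \<subseteq> N' \<and> Z - \<Union>N \<subseteq> \<Union>N' \<and> card N' = card N + card (Z - \<Union>N) \<and>
    (\<forall>e\<in>N' - N. \<exists>z\<in>Z - \<Union>N. \<exists>x\<in>R z. e = {z, x})"
  proof (rule greedy_extend[OF _ N(1)])
    fix z assume z: "z \<in> Z - \<Union>N"
    have "?n \<le> 5 * card (R z)" using z dZ2 Z by (auto simp: R_def Z1_def)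
    then have "3 * (card N + card (Z - \<Union>N)) \<le> card (R z)" using N(2) cZ' cZ a unfolding distrib_left by linarith
    then show "R z \<subseteq> nbrs E z \<and> R z \<inter> (Z - \<Union>N) = {} \<and> 3 * (card N + card (Z - \<Union>N)) \<le> card (R z)"
      using VZ by (auto simp: R_def)
  qed (use finZ in auto)
  then obtain N' where N': "rainbow_matching E c N'" "N \<subseteq> N'" "Z - \<Union>N \<subseteq> \<Union>N'"
    "card N' = card N + card (Z - \<Union>N)" "\<forall>e\<in>N' - N. \<exists>z\<in>Z - \<Union>N. \<exists>x\<in>R z. e = {z, x}" by blast
  let ?D = "N' - N"
  have D: "rainbow_matching E c ?D" by (rule rm_mono[OF N'(1)]) auto
  have sides: "e \<subseteq> ?S \<or> e \<subseteq> ?T" if eD: "e \<in> ?D" for e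
  proof -
    obtain z x where zx: "z \<in> Z" "x \<in> R z" "e = {z, x}" using bspec[OF N'(5) eD] by blast
    then show ?thesis using Z by (cases "z \<in> Z1") (auto simp: R_def)
  qed
  have UN: "\<Union>N' = \<Union>N \<union> \<Union>?D" "\<Union>N \<inter> \<Union>?D = {}"
    using N'(2) rmD(2)[OF N'(1)] by blast+
  have ev: "even (card (A - \<Union>N'))" if A: "finite A" "even (card (A - \<Union>N))" "\<And>e. e \<in> ?D \<Longrightarrow> e \<inter> A \<noteq> {} \<Longrightarrow> e \<subseteq> A" for A
  proof -
    have "A - \<Union>N' = (A - \<Union>N) - (\<Union>?D \<inter> A)" "\<Union>?D \<inter> A \<subseteq> A - \<Union>N" using UN by blast+
    moreover have "even (card (\<Union>?D \<inter> A))" by (rule even_card_covered[OF D A(3)])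
    ultimately show ?thesis using A(1,2) by (simp add: card_Diff_subset)
  qed
  let ?W1 = "?S - \<Union>N'" and ?W2 = "?T - \<Union>N'"
  have evW: "even (card ?W1)" "even (card ?W2)"
    using sides ST(2) by (blast intro!: ev fin' N(3,4))+
  have ZN: "Z \<subseteq> \<Union>N'" using N'(3) UN by blast
  then have subW: "?W1 \<subseteq> S0" "?W2 \<subseteq> T0" using Z by blast+
  have cN': "card N' \<le> 1 + 2 * a" using N'(4) N(2) cZ' cZ by linarith
  let ?E2 = "{e \<in> E. (e \<subseteq> ?W1 \<or> e \<subseteq> ?W2) \<and> c e \<notin> c ` N'}"
  interpret B: strong_graph "?W1 \<union> ?W2" ?E2 c using ST by (intro subgraph) auto
  \<comment> \<open>To the loss of \<open>2 * a\<close> neighbors recorded in \<open>dS0\<close> and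
    \<open>dT0\<close> comes \<open>3 * card N'\<close>, at most \<open>6 * a + 3\<close>; the
    inequality is doubled.\<close>
  have resid: "?n \<le> 2 * card (nbrs ?E2 v) + 16 * a + 6" if v: "v \<in> ?W1 \<union> ?W2" for v
  proof -
    have "\<exists>A. ?n \<le> 2 * card (nbrs E v \<inter> A) + 4 * a \<and> (nbrs E v \<inter> A) - \<Union>N' - bad E c N' v \<subseteq> nbrs ?E2 v"
    proof (cases "v \<in> ?W1")
      case True
      have "nbrs E v \<inter> S0 - \<Union>N' - bad E c N' v \<subseteq> nbrs ?E2 v"
        using True by (auto simp: nbrs_def bad_def)
      then show ?thesis using dS0[of v] subW(1) True by blast
    next
      case False
      then have v': "v \<in> ?W2" using v by blast
      have "nbrs E v \<inter> T0 - \<Union>N' - bad E c N' v \<subseteq> nbrs ?E2 v"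
        using v' by (auto simp: nbrs_def bad_def)
      then show ?thesis using dT0[of v] subW(2) v' by blast
    qed
    then obtain A where A: "?n \<le> 2 * card (nbrs E v \<inter> A) + 4 * a"
      "(nbrs E v \<inter> A) - \<Union>N' - bad E c N' v \<subseteq> nbrs ?E2 v" by blast
    have "card ((nbrs E v \<inter> A) - \<Union>N' - bad E c N' v) \<le> card (nbrs ?E2 v)"
      by (rule card_mono[OF B.finite_nbrs A(2)])
    then show ?thesis using card_residual_nbrs[OF N'(1), of v A] A(1) cN' by linarith
  qed
  have cW: "card (?W1 \<union> ?W2) \<le> ?n" using ST finite_V by (intro card_mono) auto
  have "card ?W1 \<le> card S" "card ?W2 \<le> card T"
    using subW sub fin by (meson card_mono subset_trans)+
  then have cW': "2 * card ?W1 \<le> ?n + a" "2 * card ?W2 \<le> ?n + a" using S(2,3) cT by linarith+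
  obtain M where M: "rainbow_matching ?E2 c M" "\<Union>M = ?W1 \<union> ?W2"
  proof (rule B.perfect_near_cliques[OF refl _ evW])
    show "?W1 \<inter> ?W2 = {}" using ST by blast
    show "e \<subseteq> ?W1 \<or> e \<subseteq> ?W2" if "e \<in> ?E2" for e using that by blast
    \<comment> \<open>Typicality is inherited: rainbow matchings of the subgraph are rainbow
      matchings of the whole graph, and passing to the subgraph only shrinks the sets of bad
      neighbors.\<close>
    show "card {v \<in> ?W1 \<union> ?W2. b < card (bad ?E2 c M v)} \<le> b" if M: "rainbow_matching ?E2 c M" for M
    proof -
      have M': "rainbow_matching E c M" by (rule rainbow_matching_supergraph[OF M]) auto
      have "card (bad ?E2 c M v) \<le> card (bad E c M v)" for v
        by (rule card_mono[OF finite_bad bad_subgraph]) auto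
      then have "{v \<in> ?W1 \<union> ?W2. b < card (bad ?E2 c M v)} \<subseteq> {v \<in> V. b < card (bad E c M v)}"
        using ST by (auto intro: less_le_trans)
      then have "card {v \<in> ?W1 \<union> ?W2. b < card (bad ?E2 c M v)} \<le> card {v \<in> V. b < card (bad E c M v)}"
        using finite_V by (intro card_mono) auto
      then show ?thesis using typical[OF M'] by linarith
    qed
    show "card (?W1 \<union> ?W2) + 2 * b < 3 * card (nbrs ?E2 v)" if "v \<in> ?W1 \<union> ?W2" for v
      using resid[OF that] cW a by linarith
    show "card ?W1 + 2 * b + 4 < 2 * card (nbrs ?E2 v)" if "v \<in> ?W1" for v
      using resid[of v] that cW' a by auto
    show "card ?W2 + 2 * b + 4 < 2 * card (nbrs ?E2 v)" if "v \<in> ?W2" for v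
      using resid[of v] that cW' a by auto
  qed
  have "?W1 \<union> ?W2 = V - \<Union>N'" using ST by blast
  then show ?thesis using complete_residual[OF N'(1) _ M(1)] M(2) by fastforce
qed

lemma rainbow_perfect_matching_if_typical:
  assumes deg: "\<And>v. v \<in> V \<Longrightarrow> card V \<le> 2 * card (nbrs E v)" and even: "even (card V)"
    and typical: "\<And>M. rainbow_matching E c M \<Longrightarrow> card {v \<in> V. b < card (bad E c M v)} \<le> b"
    and n: "400000 * (4 * b + 5) \<le> card V"
  shows "\<exists>M. rainbow_matching E c M \<and> \<Union>M = V"
proof (rule ccontr)
  assume no: "\<nexists>M. rainbow_matching E c M \<and> \<Union>M = V"
  have "4 * b < card V" using n by simp
  have "(\<exists>Y\<subseteq>V. card V \<le> 2 * card Y + (4 * b + 5) \<and> 2 * card Y \<le> card V + (4 * b + 5) \<and>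
            card {y \<in> Y. 4 * b + 5 < card (nbrs E y \<inter> Y)} \<le> 4 * b + 5) \<or>
         (\<exists>S\<subseteq>V. card V \<le> 2 * card S + (4 * b + 5) \<and> 2 * card S \<le> card V + (4 * b + 5) \<and>
            card {y \<in> S. 4 * b + 5 < card (nbrs E y - S)} \<le> 4 * b + 5 \<and>
            card {y \<in> V - S. 4 * b + 5 < card (nbrs E y \<inter> S)} \<le> 4 * b + 5)"
    by (rule stability[OF typical deg \<open>4 * b < card V\<close> even no refl])
  then show False
  proof (elim disjE exE conjE)
    fix Y assume "Y \<subseteq> V" "card V \<le> 2 * card Y + (4 * b + 5)" "2 * card Y \<le> card V + (4 * b + 5)"
      "card {y \<in> Y. 4 * b + 5 < card (nbrs E y \<inter> Y)} \<le> 4 * b + 5"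
    from near_independent_half[OF deg even _ n this] show False using no by simp
  next
    fix S assume "S \<subseteq> V" "card V \<le> 2 * card S + (4 * b + 5)" "2 * card S \<le> card V + (4 * b + 5)"
      "card {y \<in> S. 4 * b + 5 < card (nbrs E y - S)} \<le> 4 * b + 5"
      "card {y \<in> V - S. 4 * b + 5 < card (nbrs E y \<inter> S)} \<le> 4 * b + 5"
    from near_cliques[OF deg even typical _ _ _ this] show False using no n by auto
  qed
qed

end

section \<open>Large color classes\<close>

definition avg :: "'p set \<Rightarrow> ('p \<Rightarrow> 'l) \<Rightarrow> ('p \<Rightarrow> real) \<Rightarrow> 'p \<Rightarrow> real" where
  "avg \<Omega> l h p = (\<Sum>q\<in>{q \<in> \<Omega>. l q = l p}. h q) / card {q \<in> \<Omega>. l q = l p}"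

lemma avg_cong: "l p = l q \<Longrightarrow> avg \<Omega> l h p = avg \<Omega> l h q"
  by (simp add: avg_def)

text \<open>\<open>avg\<close> is the conditional expectation of \<open>h\<close> given the
  partition into fibers of \<open>l\<close>; this is its characteristic property against functions
  that are constant on the fibers.\<close>

lemma sum_mult_avg:
  assumes "finite \<Omega>" and g: "\<And>p q. p \<in> \<Omega> \<Longrightarrow> q \<in> \<Omega> \<Longrightarrow> l p = l q \<Longrightarrow> g p = g q"
  shows "(\<Sum>p\<in>\<Omega>. g p * avg \<Omega> l h p) = (\<Sum>p\<in>\<Omega>. g p * h p)"
proof -
  let ?N = "\<lambda>p. real (card {q \<in> \<Omega>. l q = l p})"
  have "(\<Sum>p\<in>\<Omega>. g p * avg \<Omega> l h p) = (\<Sum>p\<in>\<Omega>. \<Sum>q\<in>{q \<in> \<Omega>. l q = l p}. g p * h q / ?N p)"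
    by (simp add: avg_def sum_distrib_left sum_divide_distrib)
  also have "\<dots> = (\<Sum>q\<in>\<Omega>. \<Sum>p\<in>{p \<in> \<Omega>. l q = l p}. g p * h q / ?N p)"
    using sum.swap_restrict[OF assms(1,1)] by fast
  also have "\<dots> = (\<Sum>q\<in>\<Omega>. g q * h q)"
  proof (rule sum.cong[OF refl])
    fix q assume q: "q \<in> \<Omega>"
    have "(\<Sum>p\<in>{p \<in> \<Omega>. l q = l p}. g p * h q / ?N p) = (\<Sum>p\<in>{p \<in> \<Omega>. l q = l p}. g q * h q / ?N q)"
    proof (rule sum.cong[OF refl])
      fix p assume "p \<in> {p \<in> \<Omega>. l q = l p}"
      then have "p \<in> \<Omega>" "l p = l q" by simp_all
      then show "g p * h q / ?N p = g q * h q / ?N q" using g[of p q] q by simp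
    qed
    also have "\<dots> = ?N q * (g q * h q / ?N q)"
      by (simp add: eq_commute[of "l q"])
    also have "\<dots> = g q * h q" using q assms(1) by auto
    finally show "(\<Sum>p\<in>{p \<in> \<Omega>. l q = l p}. g p * h q / ?N p) = g q * h q" .
  qed
  finally show ?thesis .
qed

lemma avg_bounds:
  assumes "finite \<Omega>" "p \<in> \<Omega>" "\<And>q. q \<in> \<Omega> \<Longrightarrow> 0 \<le> h q \<and> h q \<le> 1"
  shows "0 \<le> avg \<Omega> l h p" "avg \<Omega> l h p \<le> 1"
proof -
  show "0 \<le> avg \<Omega> l h p" unfolding avg_def using assms(3) by (intro divide_nonneg_nonneg sum_nonneg) auto
  have "(\<Sum>q\<in>{q \<in> \<Omega>. l q = l p}. h q) \<le> (\<Sum>q\<in>{q \<in> \<Omega>. l q = l p}. 1)"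
    using assms(3) by (intro sum_mono) auto
  moreover have "0 < card {q \<in> \<Omega>. l q = l p}" using assms(1,2) by (auto simp: card_gt_0_iff)
  ultimately show "avg \<Omega> l h p \<le> 1" unfolding avg_def by (simp add: divide_le_eq)
qed

text \<open>\<open>g\<close> is the indicator of a union of finer parts on which the mass of
  \<open>h\<close> is at most half of what the coarse averages require there. By Pythagoras the
  energy grows by the squared distance of the two averages, and these differ by at least
  \<open>t\<close> in the mean where \<open>g\<close> is 1.\<close>

lemma energy_increment:
  assumes fin: "finite \<Omega>" and ref: "\<And>p q. p \<in> \<Omega> \<Longrightarrow> q \<in> \<Omega> \<Longrightarrow> l' p = l' q \<Longrightarrow> l p = l q"
    and g: "\<And>p q. p \<in> \<Omega> \<Longrightarrow> q \<in> \<Omega> \<Longrightarrow> l' p = l' q \<Longrightarrow> g p = g q"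
    and g01: "\<And>p. p \<in> \<Omega> \<Longrightarrow> g p = 0 \<or> g p = 1"
    and lo: "2 * t * (\<Sum>p\<in>\<Omega>. g p) \<le> (\<Sum>p\<in>\<Omega>. g p * avg \<Omega> l h p)"
    and hi: "(\<Sum>p\<in>\<Omega>. g p * h p) \<le> t * (\<Sum>p\<in>\<Omega>. g p)" and t: "0 \<le> (t::real)"
  shows "(\<Sum>p\<in>\<Omega>. (avg \<Omega> l h p)\<^sup>2) + t\<^sup>2 * (\<Sum>p\<in>\<Omega>. g p) \<le> (\<Sum>p\<in>\<Omega>. (avg \<Omega> l' h p)\<^sup>2)"
proof -
  let ?a = "avg \<Omega> l h" and ?a' = "avg \<Omega> l' h" and ?G = "\<Sum>p\<in>\<Omega>. g p"
  have "(\<Sum>p\<in>\<Omega>. ?a p * ?a' p) = (\<Sum>p\<in>\<Omega>. ?a p * h p)"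
    by (rule sum_mult_avg[OF fin], rule avg_cong, rule ref)
  also have "\<dots> = (\<Sum>p\<in>\<Omega>. ?a p * ?a p)"
    by (rule sum_mult_avg[OF fin, symmetric]) (rule avg_cong)
  finally have cross: "(\<Sum>p\<in>\<Omega>. ?a p * ?a' p) = (\<Sum>p\<in>\<Omega>. ?a p * ?a p)" .
  have "(\<Sum>p\<in>\<Omega>. (?a p - ?a' p)\<^sup>2) = (\<Sum>p\<in>\<Omega>. ?a p * ?a p) + (\<Sum>p\<in>\<Omega>. (?a' p)\<^sup>2) - 2 * (\<Sum>p\<in>\<Omega>. ?a p * ?a' p)"
    by (simp add: power2_diff sum.distrib sum_subtractf sum_distrib_left mult.assoc)
      (simp add: power2_eq_square)
  then have pyth: "(\<Sum>p\<in>\<Omega>. (?a' p)\<^sup>2) = (\<Sum>p\<in>\<Omega>. (?a p)\<^sup>2) + (\<Sum>p\<in>\<Omega>. (?a p - ?a' p)\<^sup>2)"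
    using cross by (simp add: power2_eq_square)
  have "(\<Sum>p\<in>\<Omega>. g p * ?a' p) = (\<Sum>p\<in>\<Omega>. g p * h p)" by (rule sum_mult_avg[OF fin g])
  then have "t * ?G \<le> (\<Sum>p\<in>\<Omega>. g p * ?a p) - (\<Sum>p\<in>\<Omega>. g p * ?a' p)" using lo hi by linarith
  \<comment> \<open>The pointwise bound \<open>2 * t * x - t\<^sup>2 \<le> x\<^sup>2\<close>, with
    \<open>x\<close> the drop of the average, takes the place of Cauchy-Schwarz.\<close>
  then have "2 * t * (t * ?G) - t\<^sup>2 * ?G \<le> 2 * t * ((\<Sum>p\<in>\<Omega>. g p * ?a p) - (\<Sum>p\<in>\<Omega>. g p * ?a' p)) - t\<^sup>2 * ?G"
    using t by (simp add: mult_left_mono)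
  also have "\<dots> = (\<Sum>p\<in>\<Omega>. g p * (2 * t * (?a p - ?a' p) - t\<^sup>2))"
    by (simp add: algebra_simps sum.distrib sum_subtractf sum_distrib_left sum_distrib_right)
  also have "\<dots> \<le> (\<Sum>p\<in>\<Omega>. (?a p - ?a' p)\<^sup>2)"
  proof (rule sum_mono)
    fix p assume "p \<in> \<Omega>"
    then consider "g p = 0" | "g p = 1" using g01 by blast
    then show "g p * (2 * t * (?a p - ?a' p) - t\<^sup>2) \<le> (?a p - ?a' p)\<^sup>2"
    proof cases
      case 2
      have "0 \<le> (?a p - ?a' p - t)\<^sup>2" by simp
      then show ?thesis using 2 by (simp add: power2_eq_square algebra_simps)
    qed simp
  qed
  finally show ?thesis using pyth by (simp add: power2_eq_square algebra_simps)
qed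

text \<open>A finite family \<open>F\<close> of sets stands for the partition of \<open>V\<close> into its atoms, so that refining a
  partition means enlarging \<open>F\<close>. The parts may have very different sizes.\<close>

definition atom :: "'a set set \<Rightarrow> 'a \<Rightarrow> 'a set set" where
  "atom F x = {A \<in> F. x \<in> A}"

definition atom2 :: "'a set set \<Rightarrow> 'a \<times> 'a \<Rightarrow> 'a set set \<times> 'a set set" where
  "atom2 F p = (atom F (fst p), atom F (snd p))"

definition color_density :: "'a set \<Rightarrow> 'a set set \<Rightarrow> ('a set \<Rightarrow> 'c) \<Rightarrow> 'c set \<Rightarrow> 'a set set \<Rightarrow> 'a \<times> 'a \<Rightarrow> real" where
  "color_density V E c L F =
     avg (V \<times> V) (atom2 F) (\<lambda>(x, y). if {x, y} \<in> E \<and> c {x, y} \<in> L then 1 else 0)"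

text \<open>Summing over pairs of vertices weights a pair of parts by the product of their sizes, so
  parts of unequal size do no harm.\<close>

definition energy :: "'a set \<Rightarrow> 'a set set \<Rightarrow> ('a set \<Rightarrow> 'c) \<Rightarrow> 'c set \<Rightarrow> 'a set set \<Rightarrow> real" where
  "energy V E c L F = (\<Sum>p\<in>V \<times> V. (color_density V E c L F p)\<^sup>2)"

context strong_graph
begin

section \<open>Energy increment from many large induced matchings\<close>

definition support :: "'c \<Rightarrow> 'a set" where
  "support k = \<Union>{e \<in> E. c e = k}"

lemma supportE:
  assumes "x \<in> support k" obtains x' where "{x, x'} \<in> E" "c {x, x'} = k"
proof -
  obtain e where e: "e \<in> E" "c e = k" "x \<in> e" using assms by (auto simp: support_def)
  then obtain a b where "e = {a, b}" using edgeE by metis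
  then have "e = {x, a} \<or> e = {x, b}" using e by auto
  then show ?thesis using that e by blast
qed

lemma support_subset: "support k \<subseteq> V"
  using edge_subset by (auto simp: support_def)

lemma card_support: "card (support k) = 2 * card {e \<in> E. c e = k}"
  unfolding support_def
  by (intro card_Union_matching) (auto simp: matching_def pairwise_def disjnt_def dest: strong)

text \<open>The class edges at \<open>x\<close> and at \<open>y\<close> are joined by
  \<open>xy\<close>, so they coincide and equal \<open>xy\<close>. Hence a vertex of a support has
  at most one neighbor in that support, which makes supports sparse.\<close>

lemma support_induced:
  assumes "x \<in> support k" "y \<in> support k" "{x, y} \<in> E" shows "c {x, y} = k"
proof -
  obtain x' y' where x': "{x, x'} \<in> E" "c {x, x'} = k" and y': "{y, y'} \<in> E" "c {y, y'} = k"
    using assms by (auto elim!: supportE)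
  have "{x, x'} = {y, y'}" using strong[of "{x, x'}" "{y, y'}" x y] x' y' assms(3) by auto
  then have "{x, x'} = {x, y}" using edge_neq[OF assms(3)] by auto
  then show ?thesis using x' by simp
qed

lemma energy_le: "energy V E c L F \<le> (card V)\<^sup>2"
proof -
  have "energy V E c L F \<le> (\<Sum>p\<in>V \<times> V. 1)"
    unfolding energy_def color_density_def
    using finite_V by (intro sum_mono power_le_one) (auto intro!: avg_bounds)
  then show ?thesis by (simp add: card_cartesian_product power2_eq_square)
qed

text \<open>Many large classes give many edges between parts of noticeable density, yet inside the
  support of a single color the density is close to zero. Cutting the parts along such supports
  therefore raises the energy. The gain \<open>\<gamma> ^ 8 / 512\<close> is the product of
  \<open>(\<sigma> / 2)\<^sup>2\<close>, \<open>\<rho>\<^sup>2\<close> and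
  \<open>\<gamma>\<^sup>2 / 2\<close>.\<close>

lemma energy_step:
  fixes \<gamma> :: real and F :: "'a set set"
  assumes \<gamma>: "0 < \<gamma>" and L: "L \<subseteq> c ` E" "\<gamma> * card V \<le> card L"
    and supp: "\<And>k. k \<in> L \<Longrightarrow> 2 * \<gamma> * card V \<le> card (support k)"
    and F: "finite F" and n: "64 * 2 ^ card F / \<gamma> ^ 5 \<le> card V"
  obtains G where "finite G" "card G \<le> card F + 4 ^ card F"
    "energy V E c L F + \<gamma> ^ 8 / 512 * (card V)\<^sup>2 \<le> energy V E c L G"
proof -
  define N where "N = real (card V)"
  \<comment> \<open>\<open>\<sigma>\<close> and \<open>\<rho>\<close> are the thresholds for density
    and richness; they are small enough to keep a positive share of the edges. \<open>s\<close> is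
    the part size at which one edge among \<open>\<rho> * s\<close> vertices amounts to density
    \<open>\<sigma> / 2\<close>.\<close>
  define \<sigma> where "\<sigma> = \<gamma>\<^sup>2 / 2"
  define \<rho> where "\<rho> = \<gamma> / 4"
  define s where "s = 16 / \<gamma> ^ 3"
  have pos: "0 < \<sigma>" "0 < \<rho>" "0 < s" and s: "\<sigma> / 2 * (\<rho> * s) = 1" and N0: "0 \<le> N"
    using \<gamma> by (auto simp: \<sigma>_def \<rho>_def s_def N_def field_simps power2_eq_square power3_eq_cube)
  define h where "h = (\<lambda>(x, y). if {x, y} \<in> E \<and> c {x, y} \<in> L then 1 else 0 :: real)"
  let ?\<Omega> = "V \<times> V"
  have fin: "finite ?\<Omega>" "finite V" and finL: "finite L" using finite_V L finite_E finite_surj by auto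
  define d where "d = avg ?\<Omega> (atom2 F) h"
  define bl where "bl x = {z \<in> V. atom F z = atom F x}" for x
  have bl2: "{q \<in> ?\<Omega>. atom2 F q = atom2 F (x, y)} = bl x \<times> bl y" for x y
    by (auto simp: atom2_def bl_def)
  have bl_fin: "finite (bl x)" for x using finite_V by (simp add: bl_def)
  have bl_cong: "bl x = bl x'" if "atom F x = atom F x'" for x x' using that by (simp add: bl_def)
  have bl_pos: "0 < card (bl x)" if "x \<in> V" for x
    using that bl_fin[of x] by (auto simp: card_gt_0_iff bl_def)
  define rich where "rich k x \<longleftrightarrow> \<rho> * card (bl x) \<le> card (support k \<inter> bl x)" for k x
  define T where "T = {(x, y). {x, y} \<in> E \<and> c {x, y} \<in> L}"
  define S where "S = {(x, y) \<in> T. rich (c {x, y}) x \<and> rich (c {x, y}) y \<and> s \<le> card (bl y) \<and> \<sigma> \<le> d (x, y)}"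
  have T\<Omega>: "T \<subseteq> ?\<Omega>" and finT: "finite T"
  proof -
    show "T \<subseteq> ?\<Omega>" using edge_in_V by (auto simp: T_def)
    then show "finite T" using fin finite_subset by blast
  qed
  have uniq: "y = y'" if "(x, y) \<in> T" "(x, y') \<in> T" "c {x, y} = c {x, y'}" for x y y'
  proof -
    have "{x, y} = {x, y'}" using strong[of "{x, y}" "{x, y'}" x x] that by (auto simp: T_def)
    then show ?thesis by (auto simp: doubleton_eq_iff)
  qed
  have T_sym: "(x, y) \<in> T \<longleftrightarrow> (y, x) \<in> T" for x y by (simp add: T_def insert_commute)
  have inj: "inj_on (\<lambda>(x, y). (c {x, y}, x)) T"
    using uniq by (auto intro!: inj_onI)
  have inj2: "inj_on (\<lambda>(x, y). (c {x, y}, y)) T"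
  proof (rule inj_onI)
    fix p q assume *: "p \<in> T" "q \<in> T" "(\<lambda>(x, y). (c {x, y}, y)) p = (\<lambda>(x, y). (c {x, y}, y)) q"
    obtain x y x' where "p = (x, y)" "q = (x', y)" using *(3) by (cases p; cases q) auto
    then show "p = q" using * uniq[of y x x'] T_sym by (simp add: insert_commute)
  qed
  have cT: "card T = (\<Sum>k\<in>L. card (support k))"
  proof -
    have "(\<lambda>(x, y). (c {x, y}, x)) ` T = Sigma L support"
    proof (intro equalityI subsetI)
      fix q assume "q \<in> (\<lambda>(x, y). (c {x, y}, x)) ` T"
      then show "q \<in> Sigma L support" by (auto simp: T_def support_def)
    next
      fix q assume "q \<in> Sigma L support"
      then obtain k x where q: "q = (k, x)" "k \<in> L" "x \<in> support k" by auto
      then obtain x' where "{x, x'} \<in> E" "c {x, x'} = k" by (auto elim: supportE)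
      then have "(x, x') \<in> T" "q = (\<lambda>(x, y). (c {x, y}, x)) (x, x')" using q by (auto simp: T_def)
      then show "q \<in> (\<lambda>(x, y). (c {x, y}, x)) ` T" by blast
    qed
    then have "card T = card (Sigma L support)" using card_image[OF inj] by simp
    also have "\<dots> = (\<Sum>k\<in>L. card (support k))"
      using finL support_subset finite_V by (intro card_SigmaI) (auto intro: finite_subset)
    finally show ?thesis .
  qed
  have poor: "card {x \<in> support k. \<not> rich k x} \<le> \<rho> * N" for k
  proof -
    let ?f = "\<lambda>x. if x \<in> support k then 1 else 0 :: real" and ?g = "\<lambda>x. if rich k x then 0 else 1 :: real"
    have a: "avg V (atom F) ?f x = card (support k \<inter> bl x) / card (bl x)" for x
    proof -
      have "{q \<in> V. atom F q = atom F x} = bl x" by (simp add: bl_def)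
      moreover have "(\<Sum>q\<in>bl x. ?f q) = card (support k \<inter> bl x)"
        using bl_fin[of x] by (simp add: sum.If_cases Int_commute Collect_mem_eq)
      ultimately show ?thesis by (simp add: avg_def)
    qed
    have "real (card {x \<in> support k. \<not> rich k x}) = (\<Sum>x\<in>{x \<in> support k. \<not> rich k x}. 1)" by simp
    also have "\<dots> = (\<Sum>x\<in>V. ?g x * ?f x)"
      using finite_V support_subset[of k] by (intro sum.mono_neutral_cong_left) auto
    also have "\<dots> = (\<Sum>x\<in>V. ?g x * avg V (atom F) ?f x)"
      by (rule sum_mult_avg[symmetric, OF finite_V]) (auto simp: rich_def dest: bl_cong)
    also have "\<dots> \<le> (\<Sum>x\<in>V. \<rho>)"
    proof (rule sum_mono)
      fix x assume "x \<in> V"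
      then show "?g x * avg V (atom F) ?f x \<le> \<rho>"
        using bl_pos[of x] pos by (auto simp: a rich_def divide_le_eq)
    qed
    finally show ?thesis by (simp add: N_def mult.commute)
  qed
  have small: "card {y \<in> V. card (bl y) < s} \<le> 2 ^ card F * s"
  proof -
    let ?A = "atom F ` {y \<in> V. card (bl y) < s}"
    have A: "?A \<subseteq> Pow F" by (auto simp: atom_def)
    have "{y \<in> V. card (bl y) < s} \<subseteq> (\<Union>m\<in>?A. {z \<in> V. atom F z = m})" by auto
    then have "card {y \<in> V. card (bl y) < s} \<le> card (\<Union>m\<in>?A. {z \<in> V. atom F z = m})"
      using finite_V by (intro card_mono) auto
    also have "\<dots> \<le> (\<Sum>m\<in>?A. card {z \<in> V. atom F z = m})" using finite_V by (intro card_UN_le) auto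
    finally have "real (card {y \<in> V. card (bl y) < s}) \<le> (\<Sum>m\<in>?A. real (card {z \<in> V. atom F z = m}))"
      by (simp only: of_nat_sum[symmetric] of_nat_le_iff)
    also have "\<dots> \<le> (\<Sum>m\<in>?A. s)" by (intro sum_mono) (auto simp: bl_def)
    also have "\<dots> = card ?A * s" by simp
    also have "\<dots> \<le> 2 ^ card F * s"
    proof (rule mult_right_mono)
      have "card ?A \<le> 2 ^ card F" using card_mono[OF _ A] F by (simp add: card_Pow)
      then show "real (card ?A) \<le> 2 ^ card F" using of_nat_mono[of "card ?A" "2 ^ card F"] by simp
    qed (use pos in simp)
    finally show ?thesis .
  qed
  \<comment> \<open>Of the at least \<open>2 * \<gamma> * N * card L\<close> elements of
    \<open>T\<close>, \<open>B1\<close> and \<open>B2\<close> take at most a quarter together, and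
    \<open>B3\<close> and \<open>B4\<close> at most
    \<open>3 / 4 * \<gamma>\<^sup>2 * N\<^sup>2\<close>. Since \<open>card L\<close> is at least
    \<open>\<gamma> * N\<close>, more than enough remains. The bound on \<open>B3\<close> is what
    dictates assumption \<open>n\<close>.\<close>
  have cS: "\<gamma>\<^sup>2 / 2 * N\<^sup>2 \<le> card S"
  proof -
    define B1 where "B1 = {(x, y) \<in> T. \<not> rich (c {x, y}) x}"
    define B2 where "B2 = {(x, y) \<in> T. \<not> rich (c {x, y}) y}"
    define B3 where "B3 = {(x, y) \<in> T. card (bl y) < s}"
    define B4 where "B4 = {p \<in> T. d p < \<sigma>}"
    let ?Q = "Sigma L (\<lambda>k. {x \<in> support k. \<not> rich k x})"
    have finQ: "finite ?Q"
      using finL support_subset finite_V by (auto intro: finite_subset intro!: finite_SigmaI)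
    have "card ?Q = (\<Sum>k\<in>L. card {x \<in> support k. \<not> rich k x})"
      using finL support_subset finite_V by (intro card_SigmaI) (auto intro: finite_subset)
    then have "real (card ?Q) = (\<Sum>k\<in>L. real (card {x \<in> support k. \<not> rich k x}))" by simp
    also have "\<dots> \<le> (\<Sum>k\<in>L. \<rho> * N)" using poor by (intro sum_mono)
    finally have cQ: "card ?Q \<le> card L * (\<rho> * N)" by simp
    have "card B1 = card ((\<lambda>(x, y). (c {x, y}, x)) ` B1)"
      by (rule card_image[symmetric, OF inj_on_subset[OF inj]]) (auto simp: B1_def)
    also have "\<dots> \<le> card ?Q"
      by (rule card_mono[OF finQ]) (auto simp: B1_def T_def support_def)
    finally have 1: "card B1 \<le> card L * (\<rho> * N)" using cQ by linarith
    have "card B2 = card ((\<lambda>(x, y). (c {x, y}, y)) ` B2)"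
      by (rule card_image[symmetric, OF inj_on_subset[OF inj2]]) (auto simp: B2_def)
    also have "\<dots> \<le> card ?Q"
      by (rule card_mono[OF finQ]) (auto simp: B2_def T_def support_def)
    finally have 2: "card B2 \<le> card L * (\<rho> * N)" using cQ by linarith
    have "card B3 \<le> card (V \<times> {y \<in> V. card (bl y) < s})"
      using finite_V T\<Omega> by (intro card_mono) (auto simp: B3_def)
    then have "real (card B3) \<le> real (card V * card {y \<in> V. card (bl y) < s})"
      by (simp only: card_cartesian_product of_nat_le_iff)
    also have "\<dots> = N * card {y \<in> V. card (bl y) < s}" by (simp add: N_def)
    also have "\<dots> \<le> N * (2 ^ card F * s)" using small N0 by (intro mult_left_mono)
    also have "\<dots> \<le> N * (\<gamma>\<^sup>2 / 4 * N)"
    proof (rule mult_left_mono[OF _ N0])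
      have "64 * 2 ^ card F \<le> N * \<gamma> ^ 5" using n \<gamma> by (simp add: N_def field_simps)
      then show "2 ^ card F * s \<le> \<gamma>\<^sup>2 / 4 * N"
        using \<gamma> by (simp add: s_def field_simps power2_eq_square power3_eq_cube eval_nat_numeral)
    qed
    finally have 3: "card B3 \<le> \<gamma>\<^sup>2 / 4 * N\<^sup>2" by (simp add: power2_eq_square algebra_simps)
    let ?g = "\<lambda>p. if d p < \<sigma> then 1 else 0 :: real"
    have "real (card B4) = (\<Sum>p\<in>B4. 1)" by simp
    also have "\<dots> = (\<Sum>p\<in>?\<Omega>. ?g p * h p)"
      using fin T\<Omega> by (intro sum.mono_neutral_cong_left) (auto simp: B4_def T_def h_def split: if_splits)
    also have "\<dots> = (\<Sum>p\<in>?\<Omega>. ?g p * d p)"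
      unfolding d_def by (rule sum_mult_avg[symmetric, OF fin(1)]) (simp cong: avg_cong)
    also have "\<dots> \<le> (\<Sum>p\<in>?\<Omega>. \<sigma>)" using pos by (intro sum_mono) auto
    also have "\<dots> = \<sigma> * N\<^sup>2" by (simp add: card_cartesian_product N_def power2_eq_square)
    finally have 4: "card B4 \<le> \<sigma> * N\<^sup>2" .
    have "T \<subseteq> S \<union> B1 \<union> B2 \<union> B3 \<union> B4"
      by (auto simp: S_def B1_def B2_def B3_def B4_def)
    moreover have "finite (S \<union> B1 \<union> B2 \<union> B3 \<union> B4)"
      using finT by (auto simp: S_def B1_def B2_def B3_def B4_def intro: finite_subset)
    ultimately have "card T \<le> card (S \<union> B1 \<union> B2 \<union> B3 \<union> B4)" by (rule card_mono[rotated])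
    also have "\<dots> \<le> card S + card B1 + card B2 + card B3 + card B4"
      by (meson card_Un_le add_le_mono1 order_trans)
    finally have "real (card T) \<le> card S + card B1 + card B2 + card B3 + card B4"
      by (simp flip: of_nat_add)
    moreover have "card L * (2 * \<gamma> * N) \<le> card T"
    proof -
      have "(\<Sum>k\<in>L. 2 * \<gamma> * N) \<le> (\<Sum>k\<in>L. real (card (support k)))"
        using supp by (intro sum_mono) (simp add: N_def)
      then show ?thesis by (simp add: cT)
    qed
    ultimately have "card L * (2 * \<gamma> * N) \<le> card S + 2 * (card L * (\<rho> * N)) + \<gamma>\<^sup>2 / 4 * N\<^sup>2 + \<sigma> * N\<^sup>2"
      using 1 2 3 4 by linarith
    then have "card L * (3 / 2 * \<gamma> * N) \<le> card S + 3 / 4 * \<gamma>\<^sup>2 * N\<^sup>2"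
      by (simp add: \<rho>_def \<sigma>_def algebra_simps)
    moreover have "\<gamma> * N * (3 / 2 * \<gamma> * N) \<le> card L * (3 / 2 * \<gamma> * N)"
      using L(2) \<gamma> N0 by (intro mult_right_mono) (auto simp: N_def)
    moreover have "\<gamma>\<^sup>2 * N\<^sup>2 \<ge> 0" by simp
    ultimately show ?thesis by (simp add: power2_eq_square algebra_simps)
  qed
  \<comment> \<open>A pair of parts meeting \<open>S\<close> is refined by the support of one color whose class is rich in both
    parts: inside that support the density drops to at most \<open>\<sigma> / 2\<close>, as the class is induced.\<close>
  define pick where "pick m = (SOME p. p \<in> S \<and> atom2 F p = m)" for m
  define col where "col m = c {fst (pick m), snd (pick m)}" for m
  have pick: "pick m \<in> S \<and> atom2 F (pick m) = m" if "m \<in> atom2 F ` S" for m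
    unfolding pick_def by (rule someI_ex) (use that in auto)
  \<comment> \<open>Richness in the chosen color, part size and density depend only on the pair of
    parts, so they carry over from the picked edge to every pair of vertices in these parts.\<close>
  have props: "rich (col (atom2 F (x, y))) x \<and> rich (col (atom2 F (x, y))) y \<and> s \<le> card (bl y) \<and>
      \<sigma> \<le> d (x, y)" if m: "atom2 F (x, y) \<in> atom2 F ` S" for x y
  proof -
    obtain x' y' where p: "pick (atom2 F (x, y)) = (x', y')" by force
    have S': "(x', y') \<in> S" and at: "atom2 F (x', y') = atom2 F (x, y)" using pick[OF m] p by auto
    have b: "bl x' = bl x" "bl y' = bl y" using at by (auto simp: atom2_def intro!: bl_cong)
    have dd: "d (x', y') = d (x, y)" unfolding d_def by (rule avg_cong) (rule at)
    have "col (atom2 F (x, y)) = c {x', y'}" by (simp add: col_def p)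
    then show ?thesis using S' b dd by (auto simp: S_def rich_def)
  qed
  define G where "G = F \<union> (\<lambda>m. support (col m)) ` atom2 F ` S"
  define g where "g p = (if atom2 F p \<in> atom2 F ` S \<and> fst p \<in> support (col (atom2 F p)) \<and>
      snd p \<in> support (col (atom2 F p)) then 1 else 0 :: real)" for p
  have finS: "finite S" using finT by (auto simp: S_def intro: finite_subset)
  have aF: "atom2 F ` S \<subseteq> Pow F \<times> Pow F" by (auto simp: atom2_def atom_def)
  have finG: "finite G" using F finS by (simp add: G_def)
  have cG: "card G \<le> card F + 4 ^ card F"
  proof -
    have "card ((\<lambda>m. support (col m)) ` atom2 F ` S) \<le> card (atom2 F ` S)"
      using finS by (intro card_image_le) auto
    also have "\<dots> \<le> card (Pow F \<times> Pow F)" using F aF by (intro card_mono) auto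
    also have "\<dots> = 4 ^ card F" using F by (simp add: card_cartesian_product card_Pow flip: power_mult_distrib)
    finally show ?thesis using card_Un_le[of F "(\<lambda>m. support (col m)) ` atom2 F ` S"] by (simp add: G_def)
  qed
  have refine: "atom2 F p = atom2 F q" if "atom2 G p = atom2 G q" for p q
  proof -
    have "atom F x = atom G x \<inter> F" for x by (auto simp: atom_def G_def)
    then show ?thesis using that by (auto simp: atom2_def)
  qed
  have g_inv: "g p = g q" if "atom2 G p = atom2 G q" for p q
  proof -
    have eq: "atom2 F p = atom2 F q" by (rule refine[OF that])
    have at: "atom G (fst p) = atom G (fst q)" "atom G (snd p) = atom G (snd q)"
      using that by (simp_all add: atom2_def)
    have mem: "(fst p \<in> support (col m) \<longleftrightarrow> fst q \<in> support (col m)) \<and>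
        (snd p \<in> support (col m) \<longleftrightarrow> snd q \<in> support (col m))" if m: "m \<in> atom2 F ` S" for m
    proof -
      have "support (col m) \<in> G" using m unfolding G_def by blast
      then have "support (col m) \<in> atom G x \<longleftrightarrow> x \<in> support (col m)" for x by (simp add: atom_def)
      then show ?thesis using at by metis
    qed
    show ?thesis
    proof (cases "atom2 F q \<in> atom2 F ` S")
      case True
      then show ?thesis using mem[OF True] unfolding g_def eq by simp
    qed (simp add: g_def eq)
  qed
  have lo: "2 * (\<sigma> / 2) * (\<Sum>p\<in>?\<Omega>. g p) \<le> (\<Sum>p\<in>?\<Omega>. g p * d p)"
  proof -
    have "\<sigma> * g p \<le> g p * d p" for p
      using props[of "fst p" "snd p"] by (auto simp: g_def)
    then have "(\<Sum>p\<in>?\<Omega>. \<sigma> * g p) \<le> (\<Sum>p\<in>?\<Omega>. g p * d p)" by (intro sum_mono)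
    then show ?thesis by (simp add: sum_distrib_left)
  qed
  have hi: "(\<Sum>p\<in>?\<Omega>. g p * h p) \<le> \<sigma> / 2 * (\<Sum>p\<in>?\<Omega>. g p)"
  proof -
    \<comment> \<open>For \<open>x\<close> in the chosen support, the sum on the left counts
      neighbors of \<open>x\<close> in the same support, of which there is at most one; the
      right-hand side is at least \<open>\<sigma> / 2 * (\<rho> * s)\<close>, which is 1.\<close>
    have cell: "(\<Sum>y\<in>bl z. g (x, y) * h (x, y)) \<le> \<sigma> / 2 * (\<Sum>y\<in>bl z. g (x, y))" if "z \<in> V" for x z
    proof -
      define m where "m = atom2 F (x, z)"
      have m: "atom2 F (x, y) = m" if "y \<in> bl z" for y using that by (auto simp: m_def atom2_def bl_def)
      show ?thesis
      proof (cases "m \<in> atom2 F ` S \<and> x \<in> support (col m)")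
        case False
        then have "g (x, y) = 0" if "y \<in> bl z" for y using m[OF that] by (auto simp: g_def)
        then show ?thesis by simp
      next
        case True
        have gy: "g (x, y) = (if y \<in> support (col m) then 1 else 0)" if "y \<in> bl z" for y
          using m[OF that] True by (simp add: g_def)
        have "(\<Sum>y\<in>bl z. g (x, y)) = card (support (col m) \<inter> bl z)"
          using bl_fin[of z] gy by (simp add: sum.If_cases Int_commute Collect_mem_eq cong: sum.cong)
        moreover have "\<rho> * s \<le> card (support (col m) \<inter> bl z)"
        proof -
          have "\<rho> * s \<le> \<rho> * card (bl z)" using props[of x z] True pos by (intro mult_left_mono) (auto simp: m_def)
          also have "\<dots> \<le> card (support (col m) \<inter> bl z)" using props[of x z] True by (auto simp: m_def rich_def)
          finally show ?thesis .
        qed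
        ultimately have "\<sigma> / 2 * (\<rho> * s) \<le> \<sigma> / 2 * (\<Sum>y\<in>bl z. g (x, y))"
          using pos by (intro mult_left_mono) auto
        then have A: "1 \<le> \<sigma> / 2 * (\<Sum>y\<in>bl z. g (x, y))" using s by simp
        let ?Y = "{y \<in> bl z. y \<in> support (col m) \<and> {x, y} \<in> E}"
        have "card ?Y \<le> Suc 0"
        proof (subst card_le_Suc0_iff_eq)
          show "finite ?Y" using bl_fin[of z] by simp
          show "\<forall>y\<in>?Y. \<forall>y'\<in>?Y. y = y'"
          proof (intro ballI)
            fix y y' assume y: "y \<in> ?Y" "y' \<in> ?Y"
            then have "c {x, y} = c {x, y'}" using support_induced[of x "col m"] True by auto
            then have "{x, y} = {x, y'}" using strong[of "{x, y}" "{x, y'}" x x] y by auto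
            then show "y = y'" by (auto simp: doubleton_eq_iff)
          qed
        qed
        moreover have "(\<Sum>y\<in>bl z. g (x, y) * h (x, y)) \<le> (\<Sum>y\<in>bl z. if y \<in> support (col m) \<and> {x, y} \<in> E then 1 else 0)"
          using gy by (intro sum_mono) (auto simp: h_def)
        moreover have "(\<Sum>y\<in>bl z. if y \<in> support (col m) \<and> {x, y} \<in> E then 1 else 0 :: real) = card ?Y"
          using bl_fin[of z] by (simp add: sum.If_cases Int_def conj_commute)
        ultimately show ?thesis using A by linarith
      qed
    qed
    have regroup: "(\<Sum>y\<in>V. f y) = (\<Sum>m\<in>atom F ` V. \<Sum>y\<in>{y \<in> V. atom F y = m}. f y)" for f :: "'a \<Rightarrow> real"
      using sum.image_gen[OF finite_V] by blast
    have "(\<Sum>y\<in>V. g (x, y) * h (x, y)) \<le> \<sigma> / 2 * (\<Sum>y\<in>V. g (x, y))" for x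
      unfolding regroup[of "\<lambda>y. g (x, y) * h (x, y)"] regroup[of "\<lambda>y. g (x, y)"] sum_distrib_left[of "\<sigma> / 2"]
      unfolding sum_distrib_left[of "\<sigma> / 2", symmetric]
    proof (rule order_trans[OF sum_mono])
      fix m assume "m \<in> atom F ` V"
      then obtain z where "z \<in> V" "m = atom F z" by auto
      then show "(\<Sum>y\<in>{y \<in> V. atom F y = m}. g (x, y) * h (x, y))
          \<le> \<sigma> / 2 * (\<Sum>y\<in>{y \<in> V. atom F y = m}. g (x, y))"
        using cell[of z x] by (simp add: bl_def)
    qed (simp add: sum_distrib_left)
    then have "(\<Sum>x\<in>V. \<Sum>y\<in>V. g (x, y) * h (x, y)) \<le> (\<Sum>x\<in>V. \<sigma> / 2 * (\<Sum>y\<in>V. g (x, y)))"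
      by (intro sum_mono)
    then show ?thesis by (simp add: sum.cartesian_product sum_distrib_left)
  qed
  \<comment> \<open>Averaging preserves the total of \<open>g\<close>, and at each element of
    \<open>S\<close> the average is at least \<open>\<rho>\<^sup>2\<close>, the chosen color being
    rich in both parts.\<close>
  have sum_g: "\<rho>\<^sup>2 * card S \<le> (\<Sum>p\<in>?\<Omega>. g p)"
  proof -
    have "(\<Sum>p\<in>?\<Omega>. g p) = (\<Sum>p\<in>?\<Omega>. 1 * avg ?\<Omega> (atom2 F) g p)"
      using sum_mult_avg[OF fin(1), of "atom2 F" "\<lambda>_. 1" g] by simp
    moreover have "(\<Sum>p\<in>S. \<rho>\<^sup>2) \<le> (\<Sum>p\<in>?\<Omega>. 1 * avg ?\<Omega> (atom2 F) g p)"
    proof (rule order_trans[OF sum_mono sum_mono2])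
      fix p assume p: "p \<in> S"
      obtain x y where xy: "p = (x, y)" by force
      let ?m = "atom2 F (x, y)" and ?K = "support (col (atom2 F (x, y)))"
      have xyV: "x \<in> V" "y \<in> V" using p xy T\<Omega> by (auto simp: S_def)
      have mS: "?m \<in> atom2 F ` S" using p xy by auto
      have R: "\<rho> * card (bl x) \<le> card (?K \<inter> bl x)" "\<rho> * card (bl y) \<le> card (?K \<inter> bl y)"
        using props[OF mS] by (auto simp: rich_def)
      have "(\<Sum>q\<in>bl x \<times> bl y. g q) = (\<Sum>q\<in>(?K \<inter> bl x) \<times> (?K \<inter> bl y). 1)"
      proof (rule sum.mono_neutral_cong_right)
        have m: "atom2 F q = ?m" if "q \<in> bl x \<times> bl y" for q using that by (auto simp: bl_def atom2_def)
        show "\<forall>q\<in>bl x \<times> bl y - (?K \<inter> bl x) \<times> (?K \<inter> bl y). g q = 0"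
        proof
          fix q assume q: "q \<in> bl x \<times> bl y - (?K \<inter> bl x) \<times> (?K \<inter> bl y)"
          then show "g q = 0" using m[of q] by (auto simp: g_def)
        qed
        show "g q = 1" if "q \<in> (?K \<inter> bl x) \<times> (?K \<inter> bl y)" for q
          using m[of q] that mS by (auto simp: g_def)
      qed (use bl_fin in auto)
      then have "avg ?\<Omega> (atom2 F) g p = real (card (?K \<inter> bl x)) * card (?K \<inter> bl y) / (real (card (bl x)) * card (bl y))"
        unfolding avg_def xy bl2 by (simp add: card_cartesian_product)
      moreover have "(\<rho> * card (bl x)) * (\<rho> * card (bl y)) \<le> real (card (?K \<inter> bl x)) * card (?K \<inter> bl y)"
        using R pos by (intro mult_mono) auto
      ultimately show "\<rho>\<^sup>2 \<le> 1 * avg ?\<Omega> (atom2 F) g p"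
        using bl_pos[OF xyV(1)] bl_pos[OF xyV(2)] by (simp add: le_divide_eq power2_eq_square algebra_simps)
    next
      show "0 \<le> 1 * avg ?\<Omega> (atom2 F) g p" if "p \<in> ?\<Omega> - S" for p
        unfolding avg_def by (auto intro!: divide_nonneg_nonneg sum_nonneg simp: g_def)
    qed (use fin T\<Omega> in \<open>auto simp: S_def\<close>)
    ultimately show ?thesis by (simp add: mult.commute)
  qed
  have "(\<Sum>p\<in>?\<Omega>. (d p)\<^sup>2) + (\<sigma> / 2)\<^sup>2 * (\<Sum>p\<in>?\<Omega>. g p) \<le> (\<Sum>p\<in>?\<Omega>. (avg ?\<Omega> (atom2 G) h p)\<^sup>2)"
    unfolding d_def
  proof (rule energy_increment[OF fin(1)])
    show "atom2 F p = atom2 F q" if "atom2 G p = atom2 G q" for p q by (rule refine[OF that])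
    show "g p = g q" if "atom2 G p = atom2 G q" for p q by (rule g_inv[OF that])
    show "g p = 0 \<or> g p = 1" for p by (simp add: g_def)
  qed (use lo[unfolded d_def] hi pos in simp_all)
  then have "energy V E c L F + (\<sigma> / 2)\<^sup>2 * (\<Sum>p\<in>?\<Omega>. g p) \<le> energy V E c L G"
    by (simp add: energy_def color_density_def d_def h_def)
  moreover have "\<gamma> ^ 8 / 512 * N\<^sup>2 = (\<sigma> / 2)\<^sup>2 * (\<rho>\<^sup>2 * (\<gamma>\<^sup>2 / 2 * N\<^sup>2))"
    by (simp add: \<sigma>_def \<rho>_def power2_eq_square eval_nat_numeral)
  moreover have "(\<sigma> / 2)\<^sup>2 * (\<rho>\<^sup>2 * (\<gamma>\<^sup>2 / 2 * N\<^sup>2)) \<le> (\<sigma> / 2)\<^sup>2 * (\<Sum>p\<in>?\<Omega>. g p)"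
    using cS sum_g by (intro mult_left_mono order_trans[OF _ sum_g]) auto
  ultimately have "energy V E c L F + \<gamma> ^ 8 / 512 * N\<^sup>2 \<le> energy V E c L G" by linarith
  then show ?thesis using that finG cG by (simp add: N_def)
qed

end

text \<open>Otherwise \<open>energy_step\<close> could be repeated from the trivial partition until,
  after \<open>m\<close> steps, the energy exceeded its upper bound, the square of
  \<open>card V\<close>. \<open>K i\<close> bounds the number of sets that define the partition
  after \<open>i\<close> steps; \<open>n0\<close> is large enough for the size condition of every
  step.\<close>

lemma few_large_color_classes:
  fixes \<gamma> :: real
  assumes \<gamma>: "0 < \<gamma>"
  shows "\<exists>n0. \<forall>(V :: 'a set) E (c :: 'a set \<Rightarrow> 'c). strong_graph V E c \<longrightarrow> n0 \<le> card V \<longrightarrow>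
    card {k \<in> c ` E. \<gamma> * card V \<le> card {e \<in> E. c e = k}} < \<gamma> * card V"
proof -
  define K where "K = rec_nat 0 (\<lambda>_ k. k + 4 ^ k :: nat)"
  have K: "K 0 = 0" "K (Suc i) = K i + 4 ^ K i" for i by (simp_all add: K_def)
  have K_mono: "K i \<le> K j" if "i \<le> j" for i j by (rule lift_Suc_mono_le[OF _ that]) (simp add: K)
  obtain m :: nat where m: "1 < m * (\<gamma> ^ 8 / 512)"
    using ex_less_of_nat_mult[of "\<gamma> ^ 8 / 512" 1] \<gamma> by auto
  obtain n0 :: nat where n0: "64 * 2 ^ K m / \<gamma> ^ 5 \<le> n0" using real_arch_simple by blast
  show ?thesis
  proof (intro exI[of _ "Suc n0"] allI impI)
    fix V :: "'a set" and E and c :: "'a set \<Rightarrow> 'c"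
    assume "strong_graph V E c" and n: "Suc n0 \<le> card V"
    then interpret strong_graph V E c by simp
    let ?L = "{k \<in> c ` E. \<gamma> * card V \<le> card {e \<in> E. c e = k}}"
    show "card ?L < \<gamma> * card V"
    proof (rule ccontr)
      assume "\<not> card ?L < \<gamma> * card V"
      then have L1: "?L \<subseteq> c ` E" and L2: "\<gamma> * card V \<le> card ?L" by auto
      have "\<exists>F. finite F \<and> card F \<le> K i \<and> i * (\<gamma> ^ 8 / 512) * (card V)\<^sup>2 \<le> energy V E c ?L F"
        if "i \<le> m" for i
        using that
      proof (induction i)
        case 0
        then show ?case by (intro exI[of _ "{}"]) (auto simp: energy_def intro: sum_nonneg)
      next
        case (Suc i)
        then obtain F where F: "finite F" "card F \<le> K i"
          "i * (\<gamma> ^ 8 / 512) * (card V)\<^sup>2 \<le> energy V E c ?L F" by auto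
        have "(2::real) ^ card F \<le> 2 ^ K m" using F(2) K_mono[of i m] Suc.prems by (intro power_increasing) auto
        then have "64 * 2 ^ card F / \<gamma> ^ 5 \<le> 64 * 2 ^ K m / \<gamma> ^ 5" using \<gamma> by (intro divide_right_mono) auto
        then have nF: "64 * 2 ^ card F / \<gamma> ^ 5 \<le> card V" using n0 n by linarith
        have supp: "2 * \<gamma> * card V \<le> card (support k)" if "k \<in> ?L" for k
          using that by (simp add: card_support)
        obtain G where G: "finite G" "card G \<le> card F + 4 ^ card F"
          "energy V E c ?L F + \<gamma> ^ 8 / 512 * (card V)\<^sup>2 \<le> energy V E c ?L G"
          by (rule energy_step[OF \<gamma> L1 L2 supp F(1) nF])
        have "(4::nat) ^ card F \<le> 4 ^ K i" using F(2) by (intro power_increasing) auto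
        then have "card G \<le> K (Suc i)" using G(2) F(2) unfolding K by linarith
        then show ?case using G F(3) by (intro exI[of _ G]) (simp add: algebra_simps)
      qed
      then obtain F where "m * (\<gamma> ^ 8 / 512) * (card V)\<^sup>2 \<le> energy V E c ?L F" by blast
      then have "m * (\<gamma> ^ 8 / 512) * (card V)\<^sup>2 \<le> (card V)\<^sup>2" using energy_le[of ?L F] by linarith
      moreover have "0 < (real (card V))\<^sup>2" using n by simp
      ultimately show False using m by (simp add: mult_le_cancel_right1)
    qed
  qed
qed

section \<open>Rainbow perfect matchings\<close>

context strong_graph
begin

text \<open>A vertex has at most as many bad neighbors as there are colors of \<open>M\<close> whose
  support contains it. With \<gamma> = \<beta>^2/2, summing over all vertices gives at most
  \<gamma>n * n from the large classes and n/2 * 2\<gamma>n from the others, together (\<beta>n)^2.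
  More than b = floor(\<beta>n) vertices with more than b bad neighbors each would give at least (b
  + 1)^2, which is larger.\<close>

lemma few_vertices_with_many_bad_edges:
  fixes \<beta> :: real
  assumes \<beta>: "0 < \<beta>"
    and few: "card {k \<in> c ` E. \<beta>\<^sup>2 / 2 * card V \<le> card {e \<in> E. c e = k}} < \<beta>\<^sup>2 / 2 * card V"
    and M: "rainbow_matching E c M"
  shows "card {v \<in> V. nat \<lfloor>\<beta> * card V\<rfloor> < card (bad E c M v)} \<le> nat \<lfloor>\<beta> * card V\<rfloor>"
proof (rule ccontr)
  define n where "n = real (card V)"
  define \<gamma> where "\<gamma> = \<beta>\<^sup>2 / 2"
  define b where "b = nat \<lfloor>\<beta> * n\<rfloor>"
  let ?A = "{v \<in> V. b < card (bad E c M v)}" and ?L = "{k \<in> c ` E. \<gamma> * n \<le> card {e \<in> E. c e = k}}"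
  assume "\<not> ?thesis"
  then have A: "Suc b \<le> card ?A" by (simp add: b_def n_def)
  have n0: "0 \<le> n" by (simp add: n_def)
  have finM: "finite (c ` M)" and finE: "finite (c ` E)" using rmD(4)[OF M] finite_E by auto
  have "card (bad E c M v) \<le> (\<Sum>k\<in>c ` M. if v \<in> support k then 1 else 0)" for v
  proof -
    have "card (bad E c M v) = card ((\<lambda>x. c {v, x}) ` bad E c M v)"
      using inj_on_subset[OF inj_on_color_nbrs bad_subset] by (simp add: card_image)
    also have "\<dots> \<le> card {k \<in> c ` M. v \<in> support k}"
      using finM by (intro card_mono) (auto simp: bad_def nbrs_def support_def)
    also have "\<dots> = (\<Sum>k\<in>c ` M. if v \<in> support k then 1 else 0)"
      using finM by (simp add: sum.If_cases Int_def)
    finally show ?thesis .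
  qed
  then have "(\<Sum>v\<in>V. card (bad E c M v)) \<le> (\<Sum>v\<in>V. \<Sum>k\<in>c ` M. if v \<in> support k then 1 else 0)"
    by (intro sum_mono)
  also have "\<dots> = (\<Sum>k\<in>c ` M. \<Sum>v\<in>V. if v \<in> support k then 1 else 0)" by (rule sum.swap)
  also have "\<dots> = (\<Sum>k\<in>c ` M. card (support k))"
  proof (rule sum.cong[OF refl])
    fix k
    have "V \<inter> {v. v \<in> support k} = support k" using support_subset by blast
    then show "(\<Sum>v\<in>V. if v \<in> support k then 1 else 0) = card (support k)"
      using finite_V by (simp add: sum.If_cases)
  qed
  finally have "real (\<Sum>v\<in>V. card (bad E c M v)) \<le> (\<Sum>k\<in>c ` M. real (card (support k)))"
    by (simp flip: of_nat_sum)
  also have "\<dots> \<le> (\<Sum>k\<in>c ` M. (if k \<in> ?L then n else 0) + 2 * \<gamma> * n)"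
  proof (rule sum_mono)
    fix k assume k: "k \<in> c ` M"
    show "real (card (support k)) \<le> (if k \<in> ?L then n else 0) + 2 * \<gamma> * n"
    proof (cases "k \<in> ?L")
      case True
      have "real (card (support k)) \<le> n" using card_mono[OF finite_V support_subset] by (simp add: n_def)
      moreover have "0 \<le> 2 * \<gamma> * n" using n0 by (simp add: \<gamma>_def)
      ultimately show ?thesis using True by simp
    next
      case False
      then have "card {e \<in> E. c e = k} < \<gamma> * n" using k rmD(1)[OF M] by auto
      then show ?thesis using False by (auto simp: card_support)
    qed
  qed
  also have "\<dots> = card (c ` M \<inter> ?L) * n + card (c ` M) * (2 * \<gamma> * n)"
    using finM by (simp add: sum.distrib sum.If_cases)
  also have "\<dots> \<le> \<gamma> * n * n + n / 2 * (2 * \<gamma> * n)"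
  proof (intro add_mono mult_right_mono)
    have "card (c ` M \<inter> ?L) \<le> card ?L" using finE by (intro card_mono) auto
    then show "real (card (c ` M \<inter> ?L)) \<le> \<gamma> * n" using few by (simp add: \<gamma>_def n_def)
    have "2 * card (c ` M) \<le> card V"
      using card_image[OF rmD(3)[OF M]] card_Union_rm[OF M] card_mono[OF finite_V rmD(5)[OF M]] by linarith
    then have "real (2 * card (c ` M)) \<le> n" unfolding n_def of_nat_le_iff .
    then show "real (card (c ` M)) \<le> n / 2" by simp
  qed (use n0 in \<open>auto simp: \<gamma>_def\<close>)
  also have "\<dots> = (\<beta> * n)\<^sup>2" by (simp add: \<gamma>_def power2_eq_square)
  finally have up: "real (\<Sum>v\<in>V. card (bad E c M v)) \<le> (\<beta> * n)\<^sup>2" .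
  have "Suc b * Suc b \<le> card ?A * Suc b" using A by (rule mult_le_mono1)
  also have "\<dots> = (\<Sum>v\<in>?A. Suc b)" by simp
  also have "\<dots> \<le> (\<Sum>v\<in>?A. card (bad E c M v))" by (rule sum_mono) simp
  also have "\<dots> \<le> (\<Sum>v\<in>V. card (bad E c M v))" using finite_V by (intro sum_mono2) auto
  finally have "real (Suc b * Suc b) \<le> real (\<Sum>v\<in>V. card (bad E c M v))" by (simp only: of_nat_le_iff)
  then have "real (Suc b * Suc b) \<le> (\<beta> * n)\<^sup>2" using up by (rule order_trans)
  then have sq: "(real (Suc b))\<^sup>2 \<le> (\<beta> * n)\<^sup>2" by (simp only: power2_eq_square of_nat_mult)
  have "0 \<le> \<beta> * n" using \<beta> n0 by simp
  then have "real (Suc b) \<le> \<beta> * n" by (rule power2_le_imp_le[OF sq])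
  moreover have "\<beta> * n < real (Suc b)" unfolding b_def using \<beta> n0 by (simp add: of_nat_nat) linarith
  ultimately show False by linarith
qed

end

text \<open>The set of all edges with the color of \<open>e\<close> is a maximal monochromatic set.
  An edge \<open>xy\<close> inside its vertex set belongs to the class, which is a matching, so
  \<open>xy\<close> coincides with \<open>e\<close> at \<open>x\<close> and with \<open>f\<close> at
  \<open>y\<close>.\<close>

lemma strong_graphI:
  assumes G: "simple_graph V E" and c: "strongly_edge_colored E c"
  shows "strong_graph V E c"
proof
  show "finite V" "\<And>e. e \<in> E \<Longrightarrow> e \<subseteq> V" "\<And>e. e \<in> E \<Longrightarrow> card e = 2"
    using G by (auto simp: simple_graph_def)
  fix e f x y
  assume e: "e \<in> E" and f: "f \<in> E" and eq: "c e = c f" and xy: "x \<in> e" "y \<in> f" "x = y \<or> {x, y} \<in> E"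
  let ?S = "{g \<in> E. c g = c e}"
  have "color_class E c ?S"
    unfolding color_class_def monochromatic_def
  proof (intro conjI allI impI)
    show "?S \<subseteq> E" by blast
    show "\<forall>g\<in>?S. \<forall>h\<in>?S. c g = c h" by simp
    fix T assume T: "?S \<subseteq> T \<and> T \<subseteq> E \<and> (\<forall>g\<in>T. \<forall>h\<in>T. c g = c h)"
    then have "g \<in> ?S" if "g \<in> T" for g using that e by blast
    then show "T = ?S" using T by blast
  qed
  then have S: "induced_matching E ?S" using c by (simp add: strongly_edge_colored_def)
  then have disj: "g = g'" if "g \<in> ?S" "g' \<in> ?S" "z \<in> g" "z \<in> g'" for g g' z
    using that unfolding induced_matching_def matching_def pairwise_def disjnt_def by blast
  have eS: "e \<in> ?S" "f \<in> ?S" using e f eq by auto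
  from xy(3) show "e = f"
  proof
    assume "x = y"
    then show ?thesis using disj[OF eS] xy by blast
  next
    assume E: "{x, y} \<in> E"
    have "{x, y} \<subseteq> \<Union>?S" using xy eS by blast
    then have "{x, y} \<in> ?S" using S E unfolding induced_matching_def by blast
    then show ?thesis using disj[OF eS(1), of "{x, y}" x] disj[OF eS(2), of "{x, y}" y] xy by blast
  qed
qed

lemma (in strong_graph) degree_eq_card_nbrs: "degree E v = card (nbrs E v)"
proof -
  have "{e \<in> E. v \<in> e} = (\<lambda>x. {v, x}) ` nbrs E v"
  proof (intro equalityI subsetI)
    fix e assume e: "e \<in> {e \<in> E. v \<in> e}"
    then obtain a b where ab: "e = {a, b}" using edgeE by blast
    then have "e = {v, a} \<or> e = {v, b}" using e by auto
    then show "e \<in> (\<lambda>x. {v, x}) ` nbrs E v" using e by (auto simp: nbrs_def)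
  qed (auto simp: nbrs_def)
  moreover have "inj_on (\<lambda>x. {v, x}) (nbrs E v)" by (auto simp: inj_on_def doubleton_eq_iff)
  ultimately show ?thesis by (simp add: degree_def card_image)
qed

theorem theorem1p8:
  shows "\<exists>n0::nat. \<forall>n\<ge>n0. even n \<longrightarrow>
    (\<forall>(V :: 'a set) (E :: 'a set set) (c :: 'a set \<Rightarrow> 'c).
       simple_graph V E \<and> card V = n \<and> strongly_edge_colored E c \<and>
       real (min_degree V E) \<ge> real n / 2 \<longrightarrow>
       (\<exists>M. perfect_matching V E M \<and> rainbow c M))"
proof -
  \<comment> \<open>With this value \<open>400000 * (4 * b + 5)\<close> is at most 0.16n + 2000000,
    which is below n from 3000000 on.\<close>
  define \<beta> :: real where "\<beta> = 1 / 10 ^ 7"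
  have \<beta>: "0 < \<beta>" by (simp add: \<beta>_def)
  obtain n0 where n0: "\<forall>(V :: 'a set) E (c :: 'a set \<Rightarrow> 'c). strong_graph V E c \<longrightarrow> n0 \<le> card V \<longrightarrow>
      card {k \<in> c ` E. \<beta>\<^sup>2 / 2 * card V \<le> card {e \<in> E. c e = k}} < \<beta>\<^sup>2 / 2 * card V"
    using few_large_color_classes[of "\<beta>\<^sup>2 / 2", where ?'a = 'a and ?'c = 'c] \<beta> by auto
  show ?thesis
  proof (intro exI[of _ "max n0 3000000"] allI impI, elim conjE)
    fix n and V :: "'a set" and E :: "'a set set" and c :: "'a set \<Rightarrow> 'c"
    assume n: "max n0 3000000 \<le> n" "even n" and G: "simple_graph V E" "strongly_edge_colored E c"
      and V: "card V = n" and deg: "real n / 2 \<le> real (min_degree V E)"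
    interpret strong_graph V E c by (rule strong_graphI[OF G])
    define b where "b = nat \<lfloor>\<beta> * card V\<rfloor>"
    have typical: "card {v \<in> V. b < card (bad E c M v)} \<le> b" if "rainbow_matching E c M" for M
      unfolding b_def
      by (rule few_vertices_with_many_bad_edges[OF \<beta> _ that]) (use n0 strong_graph_axioms n V in auto)
    have deg': "card V \<le> 2 * card (nbrs E v)" if "v \<in> V" for v
    proof -
      have "min_degree V E \<le> degree E v"
        unfolding min_degree_def using finite_V that by (intro Min_le) auto
      then have "real n / 2 \<le> real (card (nbrs E v))" using deg by (simp add: degree_eq_card_nbrs)
      then show ?thesis using V by linarith
    qed
    have "real b \<le> \<beta> * n" unfolding b_def V using \<beta> by (simp add: of_nat_nat)
    then have "real (400000 * (4 * b + 5)) \<le> real n" using n(1) by (simp add: \<beta>_def)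
    then have "400000 * (4 * b + 5) \<le> card V" unfolding V of_nat_le_iff .
    then obtain M where "rainbow_matching E c M" "\<Union>M = V"
      using rainbow_perfect_matching_if_typical[OF deg' _ typical] n(2) V by blast
    then show "\<exists>M. perfect_matching V E M \<and> rainbow c M"
      by (auto simp: perfect_matching_def rainbow_matching_def)
  qed
qed

end
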